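(* Let $\mathcal{H}$ be a real Hilbert space and let $f:\mathcal{H}\to\mathbb{R}$ be a convex, continuously Fréchet differentiable function whose gradient is $L$-Lipschitz continuous ($L>0$) and such that $\operatorname{argmin} f\neq\emptyset$. Let $s\in\left(0,\frac1L\right)$, $a>0$, $c>0$, $p>0$, $0<q<1$, and set $\epsilon_k=\frac{c}{k^p}$ for $k\ge 1$ and $q_k=ak^q$ for $k\ge 0$. Assume $p<2q$. Let $x_0,x_1\in\mathcal{H}$ and let $(x_k)_{k\ge0}$ and $(y_k)_{k\ge1}$ be generated, for all $k\ge1$, by $$y_k=x_k+b_{k-1}(x_k-x_{k-1})-c_kx_k,\qquad x_{k+1}=y_k-s\nabla f(y_k)-s\epsilon_k y_k,$$ where the coefficients $b_{k-1}$ and $c_k$ are the ones determined by $s$, $(q_k)$, $(\epsilon_k)$ through the formulas given in the context. Then $(x_k)$ and $(y_k)$ converge strongly to $x^*$, where $x^*$ is the minimum norm element of $\operatorname{argmin} f$ (i.e. the metric projection of $0$ onto $\operatorname{argmin} f$). Further, as $k\to+\infty$, $$f(x_k)-\min f=\mathcal{O}\left(k^{-p}\right),\qquad f(y_k)-\min f=\mathcal{O}\left(k^{-p}\right).$$ Additionally, as $k\to+\infty$, $$\|\nabla f(x_k)\|=o\left(k^{-\frac p2}\right),\qquad \|\nabla f(y_k)\|=o\left(k^{-\frac p2}\right),\qquad \|x_k-x_{k-1}\|=o\left(k^{-\frac p2}\right).$$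
   Context: The coefficients are defined for $k\ge1$ as follows. If $k=1$ or $(1-s\epsilon_{k-1})(1-s\epsilon_k)q_{k-1}q_k=0$, then $b_{k-1}=0$ and $c_k=0$. Otherwise $$b_{k-1}=\frac{(q_{k-1}-s)\left((1-s\epsilon_{k-1})^2q_{k-1}-2s\right)}{(1-s\epsilon_{k-1})(1-s\epsilon_k)q_{k-1}q_k},$$ $$c_k=\frac{2s}{(1-s\epsilon_{k-1})(1-s\epsilon_k)^2q_k}\left(\frac{s}{q_{k-1}}-\frac{s^2\epsilon_k}{q_{k-1}}-s(\epsilon_{k-1}-\epsilon_k)\right).$$ (The constant $c>0$ is distinct from the sequence $(c_k)$, and the exponent $q$ is distinct from the sequence $(q_k)$.) *)

theory Defs
  imports "HOL-Analysis.Analysis" "HOL-Library.Landau_Symbols"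
begin

definition minimizers :: "('a \<Rightarrow> real) \<Rightarrow> 'a set"
  where "minimizers f = {z. is_arg_min f (\<lambda>_. True) z}"

(* Only the values at k \<ge> 1 matter. *)
definition eps_seq :: "real \<Rightarrow> real \<Rightarrow> nat \<Rightarrow> real"
  where "eps_seq c p k = c / real k powr p"

(* For 0 < q this gives q_seq a q 0 = 0, since 0 powr q = 0. *)
definition q_seq :: "real \<Rightarrow> real \<Rightarrow> nat \<Rightarrow> real"
  where "q_seq a q k = a * real k powr q"

(* The two coefficients of step k \<ge> 1 (b with index k - 1, c with index k) are switched off
   together, exactly when the step is degenerate. *)
definition degenerate_step :: "real \<Rightarrow> (nat \<Rightarrow> real) \<Rightarrow> (nat \<Rightarrow> real) \<Rightarrow> nat \<Rightarrow> bool"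
  where "degenerate_step s \<epsilon> Q k \<longleftrightarrow>
    k = 1 \<or> (1 - s * \<epsilon> (k - 1)) * (1 - s * \<epsilon> k) * Q (k - 1) * Q k = 0"

(* b_coeff s \<epsilon> Q j is the coefficient with index j = k - 1, used in step k = Suc j. *)
definition b_coeff :: "real \<Rightarrow> (nat \<Rightarrow> real) \<Rightarrow> (nat \<Rightarrow> real) \<Rightarrow> nat \<Rightarrow> real"
  where "b_coeff s \<epsilon> Q j =
    (if degenerate_step s \<epsilon> Q (Suc j) then 0
     else (Q j - s) * ((1 - s * \<epsilon> j)^2 * Q j - 2 * s)
            / ((1 - s * \<epsilon> j) * (1 - s * \<epsilon> (Suc j)) * Q j * Q (Suc j)))"

definition c_coeff :: "real \<Rightarrow> (nat \<Rightarrow> real) \<Rightarrow> (nat \<Rightarrow> real) \<Rightarrow> nat \<Rightarrow> real"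
  where "c_coeff s \<epsilon> Q k =
    (if degenerate_step s \<epsilon> Q k then 0
     else 2 * s / ((1 - s * \<epsilon> (k - 1)) * (1 - s * \<epsilon> k)^2 * Q k)
            * (s / Q (k - 1) - s^2 * \<epsilon> k / Q (k - 1) - s * (\<epsilon> (k - 1) - \<epsilon> k)))"

end

theory Submission
  imports Defs "HOL-Real_Asymp.Real_Asymp"
begin

text \<open>
  Let \<open>F\<^sub>k z = f z + \<epsilon>\<^sub>k / 2 * \<parallel>z\<parallel>\<^sup>2\<close> with minimizer \<open>\<xi>\<^sub>k\<close>; the \<open>\<xi>\<^sub>k\<close> converge strongly to the minimum norm
  minimizer of \<open>f\<close>. Put \<open>\<tau>\<^sub>k = s / q\<^sub>k\<close>. Then \<open>b\<^sub>k\<^sub>-\<^sub>1 = 1 - 3\<tau>\<^sub>k + o(\<tau>\<^sub>k)\<close> and \<open>c\<^sub>k = O(\<tau>\<^sub>k\<^sup>2)\<close>, while \<open>p < 2q\<close> says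
  \<open>\<tau>\<^sub>k\<^sup>2 = o(\<epsilon>\<^sub>k)\<close>. The energy
  \<open>E\<^sub>k = F\<^sub>k x\<^sub>k - F\<^sub>k \<xi>\<^sub>k + \<parallel>x\<^sub>k - x\<^sub>k\<^sub>-\<^sub>1 + \<tau>\<^sub>k (x\<^sub>k\<^sub>-\<^sub>1 - \<xi>\<^sub>k)\<parallel>\<^sup>2 / (2s)\<close> contracts by a factor
  \<open>1 - \<tau>\<^sub>k\<close> in a step with frozen \<open>k\<close>, and all errors (the term \<open>c\<^sub>k x\<^sub>k\<close>, the drift of \<open>\<epsilon>\<^sub>k\<close>, \<open>\<tau>\<^sub>k\<close> and
  \<open>\<xi>\<^sub>k\<close>) are \<open>o(\<tau>\<^sub>k \<epsilon>\<^sub>k)\<close>. As \<open>q < 1\<close>, the sum of the \<open>\<tau>\<^sub>k\<close> diverges and \<open>1 / k = o(\<tau>\<^sub>k)\<close>, whence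
  \<open>E\<^sub>k = o(\<epsilon>\<^sub>k)\<close>. Strong convexity of \<open>F\<^sub>k\<close> gives \<open>\<parallel>x\<^sub>k - \<xi>\<^sub>k\<parallel>\<^sup>2 \<le> 2E\<^sub>k / \<epsilon>\<^sub>k \<rightarrow> 0\<close>, and the rates follow.
\<close>

section \<open>Norm inequalities, a damped scalar recursion, and little-o of square roots\<close>

lemma norm_sq_add:
  fixes y h :: "'a :: real_inner"
  shows "(norm (y + h))\<^sup>2 = (norm y)\<^sup>2 + 2 * (y \<bullet> h) + (norm h)\<^sup>2"
  by (simp add: power2_norm_eq_inner inner_add_left inner_add_right inner_commute)

text \<open>Weighted Young inequality: the two sides of the scalar version differ by an explicit
  square. A small \<open>\<theta>\<close> keeps the factor on \<open>u\<close> close to 1 at the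
  price of \<open>1 / \<theta>\<close> on \<open>v\<close>.\<close>

lemma norm_sq_add_le:
  fixes u v :: "'a :: real_normed_vector"
  assumes "0 < \<theta>" "\<theta> < 1"
  shows "(norm (u + v))\<^sup>2 \<le> (norm u)\<^sup>2 / (1 - \<theta>) + (norm v)\<^sup>2 / \<theta>"
proof -
  have "(norm (u + v))\<^sup>2 \<le> (norm u + norm v)\<^sup>2"
    by (intro power_mono norm_triangle_ineq) simp
  also have "\<dots> = (norm u)\<^sup>2 / (1 - \<theta>) + (norm v)\<^sup>2 / \<theta>
      - (\<theta> * norm u - (1 - \<theta>) * norm v)\<^sup>2 / (\<theta> * (1 - \<theta>))"
    using assms by (simp add: power2_eq_square divide_simps) (simp add: algebra_simps)
  also have "\<dots> \<le> (norm u)\<^sup>2 / (1 - \<theta>) + (norm v)\<^sup>2 / \<theta>" using assms by simp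
  finally show ?thesis .
qed

text \<open>Bounds the kinetic term after extrapolation by the one before, where \<open>z\<close>
  stands for the center and \<open>r + z\<close> for the current iterate. The perturbation has norm
  of order \<open>\<tau>\<^sup>2\<close>, yet it costs only order \<open>\<tau> ^ 3\<close> in the
  square while the factor \<open>1 - \<tau>\<close> survives.\<close>

lemma inertial_norm_bound:
  fixes d r z :: "'a :: real_normed_vector"
  assumes \<tau>: "0 < \<tau>" "\<tau> < 1" and b: "b = (1 - \<tau>) * \<beta>" "0 \<le> \<beta>" "\<beta> \<le> 1 - \<tau>"
    and K: "\<bar>\<tau> * (1 - \<beta>) - c\<bar> \<le> K * \<tau>\<^sup>2" "\<bar>c\<bar> \<le> K * \<tau>\<^sup>2" and z: "norm z \<le> R"
  shows "(norm (b *\<^sub>R d - c *\<^sub>R (r + z) + \<tau> *\<^sub>R r))\<^sup>2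
    \<le> (1 - \<tau>) * (norm ((1 - \<tau>) *\<^sub>R d + \<tau> *\<^sub>R r))\<^sup>2 + 2 * K\<^sup>2 * \<tau> ^ 3 * ((norm r)\<^sup>2 + R\<^sup>2)"
proof -
  define u where "u = (1 - \<tau>) *\<^sub>R d + \<tau> *\<^sub>R r"
  define B where "B = K * \<tau> * (norm r + R)"
  have K0: "0 \<le> K * \<tau>\<^sup>2" using K(2) by linarith
  \<comment> \<open>In terms of \<open>u\<close> and \<open>r\<close> instead of \<open>d\<close> and \<open>r\<close> there remain only contributions of second order in
    \<open>\<tau>\<close> besides \<open>\<beta> u\<close>.\<close>
  have "b *\<^sub>R d - c *\<^sub>R (r + z) + \<tau> *\<^sub>R r = \<beta> *\<^sub>R u + (\<tau> * (1 - \<beta>) - c) *\<^sub>R r - c *\<^sub>R z"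
    by (simp add: u_def b(1) algebra_simps)
  hence "norm (b *\<^sub>R d - c *\<^sub>R (r + z) + \<tau> *\<^sub>R r)
      \<le> norm (\<beta> *\<^sub>R u) + norm ((\<tau> * (1 - \<beta>) - c) *\<^sub>R r) + norm (c *\<^sub>R z)"
    using norm_triangle_ineq4[of "\<beta> *\<^sub>R u + (\<tau> * (1 - \<beta>) - c) *\<^sub>R r" "c *\<^sub>R z"]
      norm_triangle_ineq[of "\<beta> *\<^sub>R u" "(\<tau> * (1 - \<beta>) - c) *\<^sub>R r"] by simp
  also have "\<dots> \<le> (1 - \<tau>) * norm u + K * \<tau>\<^sup>2 * norm r + K * \<tau>\<^sup>2 * R"
    unfolding norm_scaleR using b K z K0 by (intro add_mono mult_mono) auto
  also have "\<dots> = (1 - \<tau>) * norm u + \<tau> * B" by (simp add: B_def power2_eq_square algebra_simps)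
  finally have "(norm (b *\<^sub>R d - c *\<^sub>R (r + z) + \<tau> *\<^sub>R r))\<^sup>2 \<le> ((1 - \<tau>) * norm u + \<tau> * B)\<^sup>2"
    by (intro power_mono) auto
  \<comment> \<open>Convexity of the square with weights \<open>1 - \<tau>\<close> and
    \<open>\<tau>\<close>, with its exact defect. Since \<open>B\<close> is of order
    \<open>\<tau>\<close>, the error is of third order.\<close>
  also have "\<dots> = (1 - \<tau>) * (norm u)\<^sup>2 + \<tau> * B\<^sup>2 - \<tau> * (1 - \<tau>) * (norm u - B)\<^sup>2"
    by (simp add: power2_eq_square algebra_simps)
  also have "\<dots> \<le> (1 - \<tau>) * (norm u)\<^sup>2 + \<tau> * B\<^sup>2"
    using \<tau> by simp
  also have "\<tau> * B\<^sup>2 \<le> 2 * K\<^sup>2 * \<tau> ^ 3 * ((norm r)\<^sup>2 + R\<^sup>2)"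
  proof -
    have "(norm r + R)\<^sup>2 \<le> 2 * ((norm r)\<^sup>2 + R\<^sup>2)"
      using zero_le_power2[of "norm r - R"] by (simp add: power2_eq_square algebra_simps)
    hence "K\<^sup>2 * \<tau> ^ 3 * (norm r + R)\<^sup>2 \<le> K\<^sup>2 * \<tau> ^ 3 * (2 * ((norm r)\<^sup>2 + R\<^sup>2))"
      using \<tau> by (intro mult_left_mono) auto
    thus ?thesis by (simp add: B_def power2_eq_square power3_eq_cube algebra_simps)
  qed
  finally show ?thesis by (simp add: u_def)
qed

text \<open>Once \<open>\<sigma> k < h\<close>, the excess \<open>A k - h\<close> is multiplied by
  at most \<open>1 - t k \<le> exp (- t k)\<close>; divergence of the sum of the \<open>t k\<close>
  drives the product of these factors to 0.\<close>

lemma damped_recursion_tendsto_0: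
  fixes A t \<sigma> :: "nat \<Rightarrow> real"
  assumes nonneg: "\<And>k. 0 \<le> A k" and t_pos: "\<And>k. k \<ge> 1 \<Longrightarrow> 0 \<le> t k" and t_lim: "t \<longlonglongrightarrow> 0"
    and t_sum: "\<not> summable t" and \<sigma>: "\<sigma> \<longlonglongrightarrow> 0"
    and rec: "eventually (\<lambda>k. A (Suc k) \<le> (1 - t k) * A k + t k * \<sigma> k) sequentially"
  shows "A \<longlonglongrightarrow> 0"
proof (rule order_tendstoI)
  fix \<eta> :: real assume "\<eta> < 0"
  thus "eventually (\<lambda>k. \<eta> < A k) sequentially"
    using nonneg by (intro always_eventually) (meson less_le_trans)
next
  fix \<eta> :: real assume \<eta>: "0 < \<eta>"
  define h where "h = \<eta> / 2"
  have h: "0 < h" "h < \<eta>" using \<eta> by (auto simp: h_def)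
  have "eventually (\<lambda>k. A (Suc k) \<le> (1 - t k) * A k + t k * \<sigma> k \<and> \<sigma> k < h \<and> t k < 1 \<and> k \<ge> 1) sequentially"
    using rec order_tendstoD(2)[OF \<sigma> h(1)] order_tendstoD(2)[OF t_lim zero_less_one]
      eventually_ge_at_top[of "1::nat"] by eventually_elim auto
  then obtain N where N: "\<And>k. k \<ge> N \<Longrightarrow> A (Suc k) \<le> (1 - t k) * A k + t k * \<sigma> k"
      "\<And>k. k \<ge> N \<Longrightarrow> \<sigma> k < h" "\<And>k. k \<ge> N \<Longrightarrow> t k < 1" "N \<ge> 1"
    unfolding eventually_sequentially by (metis le_refl)
  \<comment> \<open>The maximum with 0 covers the case that \<open>A N\<close> is already below
    \<open>h\<close>.\<close>
  define B where "B = max (A N - h) 0"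
  have B: "0 \<le> B" by (simp add: B_def)
  have decay: "A (N + m) - h \<le> exp (- (\<Sum>i<m. t (N + i))) * B" for m
  proof (induction m)
    case (Suc m)
    have t: "0 \<le> t (N + m)" "t (N + m) < 1" using N t_pos by auto
    have "t (N + m) * \<sigma> (N + m) \<le> t (N + m) * h"
      using t N(2)[of "N + m"] by (intro mult_left_mono) auto
    hence "A (N + Suc m) - h \<le> (1 - t (N + m)) * (A (N + m) - h)"
      using N(1)[of "N + m"] by (simp add: algebra_simps)
    also have "\<dots> \<le> (1 - t (N + m)) * (exp (- (\<Sum>i<m. t (N + i))) * B)"
      using Suc.IH t by (intro mult_left_mono) auto
    also have "\<dots> \<le> exp (- t (N + m)) * (exp (- (\<Sum>i<m. t (N + i))) * B)"
      using B exp_ge_add_one_self[of "- t (N + m)"] by (intro mult_right_mono) auto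
    also have "\<dots> = exp (- (\<Sum>i<Suc m. t (N + i))) * B"
      by (simp add: exp_add[symmetric] mult.assoc[symmetric])
    finally show ?case .
  qed (simp add: B_def)
  have "\<not> summable (\<lambda>i. t (N + i))"
    using t_sum summable_iff_shift[of t N] by (simp add: add.commute)
  hence unbdd: "\<not> (\<forall>m. (\<Sum>i<m. t (N + i)) \<le> C)" for C
    using summableI_nonneg_bounded[of "\<lambda>i. t (N + i)" C] t_pos N(4) by fastforce
  have mono: "mono (\<lambda>m. \<Sum>i<m. t (N + i))"
    unfolding mono_iff_le_Suc using t_pos N(4) by simp
  \<comment> \<open>This makes the decayed excess at most \<open>h * B / (B + 1) < h\<close>, hence
    \<open>A k < 2 * h = \<eta>\<close>; \<open>B + 1\<close> avoids a division by 0.\<close>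
  obtain m0 where m0: "(\<Sum>i<m0. t (N + i)) > ln ((B + 1) / h)" using unbdd by (auto simp: not_le)
  have "A k < \<eta>" if "k \<ge> N + m0" for k
  proof -
    obtain m where k: "k = N + m" "m \<ge> m0" using \<open>k \<ge> N + m0\<close> by (metis add_le_cancel_left nat_le_iff_add add_leD1)
    have "ln ((B + 1) / h) \<le> (\<Sum>i<m. t (N + i))" using m0 monoD[OF mono k(2)] by linarith
    hence "exp (- (\<Sum>i<m. t (N + i))) \<le> exp (- ln ((B + 1) / h))" by simp
    also have "\<dots> = h / (B + 1)" using B h by (simp add: exp_minus)
    finally have "exp (- (\<Sum>i<m. t (N + i))) * B \<le> h / (B + 1) * B" using B by (rule mult_right_mono)
    also have "\<dots> < h" using B h by (simp add: field_simps)
    finally show ?thesis using decay[of m] k by (simp add: h_def)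
  qed
  thus "eventually (\<lambda>k. A k < \<eta>) sequentially" unfolding eventually_sequentially by blast
qed

lemma smallo_sqrtI:
  fixes h \<epsilon> :: "nat \<Rightarrow> real"
  assumes "(\<lambda>k. (h k)\<^sup>2) \<in> o(\<epsilon>)"
  shows "h \<in> o(\<lambda>k. sqrt (\<epsilon> k))"
proof (rule landau_o.smallI)
  fix C :: real assume C: "0 < C"
  have "eventually (\<lambda>k. norm ((h k)\<^sup>2) \<le> C\<^sup>2 * norm (\<epsilon> k)) sequentially"
    using landau_o.smallD[OF assms, of "C\<^sup>2"] C by simp
  thus "eventually (\<lambda>k. norm (h k) \<le> C * norm (sqrt (\<epsilon> k))) sequentially"
  proof eventually_elim
    case (elim k)
    hence "sqrt ((h k)\<^sup>2) \<le> sqrt (C\<^sup>2 * \<bar>\<epsilon> k\<bar>)" by (intro real_sqrt_le_mono) simp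
    \<comment> \<open>\<open>sqrt\<close> is extended to negative arguments as an odd function, so
      no sign condition on \<open>\<epsilon>\<close> is required.\<close>
    moreover have "\<bar>sqrt (\<epsilon> k)\<bar> = sqrt \<bar>\<epsilon> k\<bar>" by (cases "0 \<le> \<epsilon> k") (simp_all add: real_sqrt_minus)
    ultimately show ?case using C by (simp add: real_sqrt_mult)
  qed
qed

subsection \<open>Regularised smooth convex functions\<close>

locale smooth_convex =
  fixes f :: "'a :: {real_inner, complete_space} \<Rightarrow> real"
    and g :: "'a \<Rightarrow> 'a" and L :: real
  assumes convex: "convex_on UNIV f"
    and gradient: "GDERIV f z :> g z"
    and L_pos: "0 < L"
    and lipschitz: "L-lipschitz_on UNIV g"
begin

section \<open>Tangent and parabola bounds for \<open>f\<close>\<close>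

lemma has_derivative_along_line:
  "((\<lambda>t. f (y + t *\<^sub>R h)) has_real_derivative g (y + t *\<^sub>R h) \<bullet> h) (at t)"
proof -
  have "((\<lambda>t. f (y + t *\<^sub>R h)) has_derivative (\<lambda>u. (u *\<^sub>R h) \<bullet> g (y + t *\<^sub>R h))) (at t)"
    by (rule has_derivative_compose[where g = f, OF _ gradient[unfolded gderiv_def]])
       (auto intro!: derivative_eq_intros)
  thus ?thesis
    by (simp add: has_field_derivative_def inner_commute mult.commute[of _ "_ \<bullet> _"])
qed

lemma above_tangent: "f z \<ge> f y + g y \<bullet> (z - y)"
proof -
  define \<phi> where "\<phi> t = f (y + t *\<^sub>R (z - y))" for t
  have "convex_on UNIV \<phi>"
  proof (rule convex_onI)
    fix t u v :: real assume t: "0 < t" "t < 1"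
    have "y + ((1 - t) *\<^sub>R u + t *\<^sub>R v) *\<^sub>R (z - y)
        = (1 - t) *\<^sub>R (y + u *\<^sub>R (z - y)) + t *\<^sub>R (y + v *\<^sub>R (z - y))"
      by (simp add: algebra_simps)
    thus "\<phi> ((1 - t) *\<^sub>R u + t *\<^sub>R v) \<le> (1 - t) * \<phi> u + t * \<phi> v"
      unfolding \<phi>_def using convex_onD[OF convex, of t] t by simp
  qed simp
  moreover have "(\<phi> has_real_derivative g y \<bullet> (z - y)) (at 0 within UNIV)"
    using has_derivative_along_line[of y "z - y" 0] by (simp add: \<phi>_def[abs_def])
  ultimately have "\<phi> 1 - \<phi> 0 \<ge> (g y \<bullet> (z - y)) * (1 - 0)"
    by (intro convex_on_imp_above_tangent[of UNIV]) auto
  thus ?thesis by (simp add: \<phi>_def)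
qed

text \<open>Descent lemma: along the segment, \<open>\<psi>\<close> subtracts the claimed quadratic
  bound from \<open>f\<close>, and the Lipschitz condition on the gradient makes its derivative
  nonpositive.\<close>

lemma below_parabola: "f (y + h) \<le> f y + g y \<bullet> h + L / 2 * (norm h)\<^sup>2"
proof -
  define \<psi> where "\<psi> t = f (y + t *\<^sub>R h) - t * (g y \<bullet> h) - L / 2 * t\<^sup>2 * (norm h)\<^sup>2" for t
  have "\<psi> 1 \<le> \<psi> 0"
  proof (rule DERIV_nonpos_imp_nonincreasing[of 0 1])
    fix t :: real assume t: "0 \<le> t" "t \<le> 1"
    have "(\<psi> has_real_derivative (g (y + t *\<^sub>R h) \<bullet> h - g y \<bullet> h - L * t * (norm h)\<^sup>2)) (at t)"
      unfolding \<psi>_def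
      by (auto intro!: derivative_eq_intros has_derivative_along_line)
    moreover have "g (y + t *\<^sub>R h) \<bullet> h - g y \<bullet> h \<le> L * t * (norm h)\<^sup>2"
    proof -
      have "g (y + t *\<^sub>R h) \<bullet> h - g y \<bullet> h \<le> norm (g (y + t *\<^sub>R h) - g y) * norm h"
        using norm_cauchy_schwarz[of "g (y + t *\<^sub>R h) - g y" h] by (simp add: inner_diff_left)
      also have "\<dots> \<le> (L * norm (t *\<^sub>R h)) * norm h"
        using lipschitz_onD[OF lipschitz, of "y + t *\<^sub>R h" y]
        by (intro mult_right_mono) (auto simp: dist_norm)
      finally show ?thesis using t by (simp add: power2_eq_square algebra_simps)
    qed
    ultimately show "\<exists>D. (\<psi> has_real_derivative D) (at t) \<and> D \<le> 0"
      by (metis diff_le_0_iff_le)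
  qed simp
  thus ?thesis by (simp add: \<psi>_def)
qed

section \<open>First-order inequalities for \<open>reg \<mu>\<close>, which is
  \<open>F\<^sub>k\<close> when \<open>\<mu> = \<epsilon> k\<close>\<close>

definition reg :: "real \<Rightarrow> 'a \<Rightarrow> real"
  where "reg \<mu> z = f z + \<mu> / 2 * (norm z)\<^sup>2"

definition reg_grad :: "real \<Rightarrow> 'a \<Rightarrow> 'a"
  where "reg_grad \<mu> z = g z + \<mu> *\<^sub>R z"

lemma reg_strongly_convex:
  "reg \<mu> (y + h) \<ge> reg \<mu> y + reg_grad \<mu> y \<bullet> h + \<mu> / 2 * (norm h)\<^sup>2"
  using above_tangent[of y "y + h"] unfolding reg_def reg_grad_def norm_sq_add
  by (simp add: algebra_simps)

lemma reg_below_parabola: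
  "reg \<mu> (y + h) \<le> reg \<mu> y + reg_grad \<mu> y \<bullet> h + (L + \<mu>) / 2 * (norm h)\<^sup>2"
  using below_parabola[of y h] unfolding reg_def reg_grad_def norm_sq_add
  by (simp add: algebra_simps add_divide_distrib)

lemma reg_above_center:
  assumes "reg_grad \<mu> z = 0"
  shows "reg \<mu> y \<ge> reg \<mu> z + \<mu> / 2 * (norm (y - z))\<^sup>2"
  using reg_strongly_convex[of \<mu> z "y - z"] assms by simp

lemma reg_gradient_step:
  assumes "0 < s" "s * (L + \<mu>) \<le> 1"
  shows "reg \<mu> (y - s *\<^sub>R reg_grad \<mu> y) \<le> reg \<mu> y - s / 2 * (norm (reg_grad \<mu> y))\<^sup>2"
proof -
  have "s * (s * (L + \<mu>)) / 2 * (norm (reg_grad \<mu> y))\<^sup>2 \<le> s * 1 / 2 * (norm (reg_grad \<mu> y))\<^sup>2"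
    using assms by (intro mult_right_mono divide_right_mono mult_left_mono) auto
  hence "(L + \<mu>) / 2 * (norm (- s *\<^sub>R reg_grad \<mu> y))\<^sup>2 \<le> s / 2 * (norm (reg_grad \<mu> y))\<^sup>2"
    by (simp add: power_mult_distrib power2_eq_square[of s] ac_simps)
  moreover have "reg_grad \<mu> y \<bullet> (- s *\<^sub>R reg_grad \<mu> y) = - s * (norm (reg_grad \<mu> y))\<^sup>2"
    by (simp add: power2_norm_eq_inner)
  moreover have "reg \<mu> (y - s *\<^sub>R reg_grad \<mu> y) \<le> reg \<mu> y
      + reg_grad \<mu> y \<bullet> (- s *\<^sub>R reg_grad \<mu> y) + (L + \<mu>) / 2 * (norm (- s *\<^sub>R reg_grad \<mu> y))\<^sup>2"
    using reg_below_parabola[of \<mu> y "- s *\<^sub>R reg_grad \<mu> y"]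
    by (simp only: scaleR_minus_left add_uminus_conv_diff)
  ultimately show ?thesis by linarith
qed

lemma gradient_monotone: "(g y - g z) \<bullet> (y - z) \<ge> 0"
  using above_tangent[of y z] above_tangent[of z y]
  by (simp add: algebra_simps inner_diff_left inner_diff_right)

text \<open>A gradient step of length \<open>1 / (L + \<mu>)\<close> from \<open>y\<close> gains at
  least the squared gradient norm divided by \<open>2 * (L + \<mu>)\<close>, and it cannot fall
  below the minimum at \<open>z\<close>.\<close>

lemma reg_grad_bound:
  assumes "reg_grad \<mu> z = 0" "0 \<le> \<mu>"
  shows "(norm (reg_grad \<mu> y))\<^sup>2 \<le> 2 * (L + \<mu>) * (reg \<mu> y - reg \<mu> z)"
proof -
  have pos: "L + \<mu> > 0" using L_pos assms(2) by simp
  have "reg \<mu> z \<le> reg \<mu> (y - (1 / (L + \<mu>)) *\<^sub>R reg_grad \<mu> y)"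
    using reg_above_center[OF assms(1), of "y - (1 / (L + \<mu>)) *\<^sub>R reg_grad \<mu> y"] assms(2)
      zero_le_power2[of "norm (y - (1 / (L + \<mu>)) *\<^sub>R reg_grad \<mu> y - z)"]
      mult_nonneg_nonneg[of "\<mu> / 2" "(norm (y - (1 / (L + \<mu>)) *\<^sub>R reg_grad \<mu> y - z))\<^sup>2"]
    by linarith
  also have "\<dots> \<le> reg \<mu> y - 1 / (L + \<mu>) / 2 * (norm (reg_grad \<mu> y))\<^sup>2"
    using pos by (intro reg_gradient_step) auto
  finally show ?thesis using pos by (simp add: field_simps)
qed

text \<open>With \<open>reg 0 = f\<close>, a gradient step of length \<open>1 / L\<close> would
  improve on a minimizer with nonzero gradient; the converse is the tangent inequality.\<close>

lemma minimizers_iff: "z \<in> minimizers f \<longleftrightarrow> g z = 0"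
proof
  assume "z \<in> minimizers f"
  hence *: "f z \<le> f w" for w by (auto simp: minimizers_def is_arg_min_linorder)
  have "reg 0 z \<le> reg 0 (z - (1 / L) *\<^sub>R reg_grad 0 z)"
    using * by (simp add: reg_def)
  also have "\<dots> \<le> reg 0 z - 1 / L / 2 * (norm (reg_grad 0 z))\<^sup>2"
    using L_pos by (intro reg_gradient_step) auto
  finally have "1 / L / 2 * (norm (reg_grad 0 z))\<^sup>2 \<le> 0" by simp
  thus "g z = 0" using L_pos by (simp add: reg_grad_def mult_le_0_iff divide_le_0_iff)
next
  assume "g z = 0"
  thus "z \<in> minimizers f"
    using above_tangent[of z] by (simp add: minimizers_def is_arg_min_linorder)
qed

section \<open>Existence, drift and convergence of the regularised minimizers\<close>

lemma ex_reg_minimizer: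
  assumes "0 < \<mu>"
  shows "\<exists>z. reg_grad \<mu> z = 0"
proof -
  define M where "M = L + \<mu>"
  \<comment> \<open>This step length minimizes
    \<open>1 - 2 * t * \<mu> + t\<^sup>2 * M\<^sup>2\<close>, the squared contraction factor of
    \<open>T\<close> that follows from strong monotonicity and the Lipschitz bound on
    \<open>reg_grad \<mu>\<close>. The minimizer is then a Banach fixed point.\<close>
  define t where "t = \<mu> / M\<^sup>2"
  define T where "T z = z - t *\<^sub>R reg_grad \<mu> z" for z
  define \<kappa> where "\<kappa> = sqrt (1 - \<mu>\<^sup>2 / M\<^sup>2)"
  have M: "M > 0" "\<mu> < M" "0 < t" using assms L_pos by (auto simp: M_def t_def)
  have ratio: "0 < \<mu>\<^sup>2 / M\<^sup>2" "\<mu>\<^sup>2 / M\<^sup>2 < 1"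
    using M assms by (auto simp: divide_less_eq power_strict_mono)
  have contr: "dist (T y) (T z) \<le> \<kappa> * dist y z" for y z
  proof -
    define d e where "d = y - z" and "e = reg_grad \<mu> y - reg_grad \<mu> z"
    have "norm e \<le> norm (g y - g z) + norm (\<mu> *\<^sub>R (y - z))"
      unfolding e_def reg_grad_def
      using norm_triangle_ineq[of "g y - g z" "\<mu> *\<^sub>R (y - z)"] by (simp add: algebra_simps)
    also have "\<dots> \<le> L * norm d + \<mu> * norm d"
      using lipschitz_onD[OF lipschitz, of y z] assms by (simp add: dist_norm d_def)
    finally have "norm e \<le> M * norm d" by (simp add: M_def algebra_simps)
    hence e: "(norm e)\<^sup>2 \<le> M\<^sup>2 * (norm d)\<^sup>2"
      using power_mono[of "norm e" "M * norm d" 2] by (simp add: power_mult_distrib)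
    have mono: "d \<bullet> e \<ge> \<mu> * (norm d)\<^sup>2"
      using gradient_monotone[of y z]
      unfolding d_def e_def reg_grad_def power2_norm_eq_inner
      by (simp add: inner_diff_left inner_diff_right inner_add_left inner_add_right inner_commute algebra_simps)
    have "(norm (T y - T z))\<^sup>2 = (norm (d + (- t) *\<^sub>R e))\<^sup>2"
      by (simp add: T_def d_def e_def algebra_simps)
    also have "\<dots> = (norm d)\<^sup>2 - 2 * t * (d \<bullet> e) + t\<^sup>2 * (norm e)\<^sup>2"
      unfolding norm_sq_add by (simp add: power_mult_distrib)
    also have "\<dots> \<le> (norm d)\<^sup>2 - 2 * t * (\<mu> * (norm d)\<^sup>2) + t\<^sup>2 * (M\<^sup>2 * (norm d)\<^sup>2)"
      using mono e M by (intro add_mono diff_mono mult_left_mono) auto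
    also have "\<dots> = (1 - \<mu>\<^sup>2 / M\<^sup>2) * (norm d)\<^sup>2"
      using M by (simp add: t_def field_simps power2_eq_square)
    finally have "norm (T y - T z) \<le> sqrt ((1 - \<mu>\<^sup>2 / M\<^sup>2) * (norm d)\<^sup>2)"
      by (rule real_le_rsqrt)
    thus ?thesis by (simp add: \<kappa>_def real_sqrt_mult dist_norm d_def)
  qed
  have "\<exists>!z. T z = z"
    by (rule banach_fix_type[of \<kappa>]) (use ratio contr in \<open>auto simp: \<kappa>_def\<close>)
  thus ?thesis using M by (auto simp: T_def)
qed

text \<open>For \<open>\<mu> > 0\<close> this is the unique minimizer of \<open>reg \<mu>\<close>;
  \<open>center (\<epsilon> k)\<close> is \<open>\<xi>\<^sub>k\<close>.\<close>

definition center :: "real \<Rightarrow> 'a"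
  where "center \<mu> = (SOME z. reg_grad \<mu> z = 0)"

lemma reg_grad_center: "0 < \<mu> \<Longrightarrow> reg_grad \<mu> (center \<mu>) = 0"
  unfolding center_def by (rule someI_ex[OF ex_reg_minimizer])

text \<open>Monotonicity of the gradient, with both gradients eliminated through criticality. The
  choice \<open>\<nu> = 0\<close> compares with a minimizer of \<open>f\<close>.\<close>

lemma critical_points_inner:
  assumes "reg_grad \<mu> y = 0" "reg_grad \<nu> z = 0"
  shows "(\<mu> *\<^sub>R y - \<nu> *\<^sub>R z) \<bullet> (y - z) \<le> 0"
proof -
  have "g y - g z = - (\<mu> *\<^sub>R y - \<nu> *\<^sub>R z)"
    using assms by (simp add: reg_grad_def add_eq_0_iff2)
  thus ?thesis using gradient_monotone[of y z] by (simp only: inner_minus_left)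
qed

lemma critical_points_dist_sq:
  assumes "reg_grad \<mu> y = 0" "reg_grad \<nu> z = 0"
  shows "(\<mu> + \<nu>) * (norm (y - z))\<^sup>2 \<le> (\<mu> - \<nu>) * ((norm z)\<^sup>2 - (norm y)\<^sup>2)"
  using critical_points_inner[OF assms] unfolding power2_norm_eq_inner
  by (simp add: inner_diff_left inner_diff_right inner_commute algebra_simps)

text \<open>Controls the drift of the centers: the relative change of the regularisation parameter
  bounds their displacement relative to \<open>norm z\<close>.\<close>

lemma critical_points_dist:
  assumes "reg_grad \<mu> y = 0" "reg_grad \<nu> z = 0" "\<nu> \<le> \<mu>"
  shows "\<mu> * norm (y - z) \<le> (\<mu> - \<nu>) * norm z"
proof (cases "y = z")
  case False
  have "\<mu> * (norm (y - z))\<^sup>2 \<le> (\<mu> - \<nu>) * (z \<bullet> (z - y))"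
    using critical_points_inner[OF assms(1,2)] unfolding power2_norm_eq_inner
    by (simp add: inner_diff_left inner_diff_right inner_commute algebra_simps)
  also have "\<dots> \<le> (\<mu> - \<nu>) * (norm z * norm (y - z))"
    using assms(3) norm_cauchy_schwarz[of z "z - y"]
    by (intro mult_left_mono) (auto simp: norm_minus_commute)
  finally have "norm (y - z) * (\<mu> * norm (y - z)) \<le> norm (y - z) * ((\<mu> - \<nu>) * norm z)"
    by (simp add: power2_eq_square algebra_simps)
  thus ?thesis using False by simp
qed (use assms in simp)

lemma norm_center_le:
  assumes "g z = 0" "0 < \<mu>"
  shows "norm (center \<mu>) \<le> norm z"
proof -
  have "\<mu> * (norm (center \<mu> - z))\<^sup>2 \<le> \<mu> * ((norm z)\<^sup>2 - (norm (center \<mu>))\<^sup>2)"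
    using critical_points_dist_sq[OF reg_grad_center[OF assms(2)], of 0 z] assms
    by (simp add: reg_grad_def)
  hence "(norm (center \<mu> - z))\<^sup>2 \<le> (norm z)\<^sup>2 - (norm (center \<mu>))\<^sup>2" using assms(2) by simp
  hence "(norm (center \<mu>))\<^sup>2 \<le> (norm z)\<^sup>2"
    using zero_le_power2[of "norm (center \<mu> - z)"] by linarith
  thus ?thesis by (rule power2_le_imp_le) simp
qed


text \<open>The norms of the centers are monotone and bounded and control the distances between the centers,
  so the centers are Cauchy and no weak compactness is needed.\<close>

lemma centers_converge:
  assumes pos: "\<And>k. 0 < \<epsilon> k" and decr: "\<And>k. \<epsilon> (Suc k) \<le> \<epsilon> k"
    and lim: "\<epsilon> \<longlonglongrightarrow> 0" and ex: "g z0 = 0"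
  obtains xs where "(\<lambda>k. center (\<epsilon> k)) \<longlonglongrightarrow> xs" "g xs = 0"
    "\<And>z. g z = 0 \<Longrightarrow> norm z \<le> norm xs \<Longrightarrow> z = xs" "\<And>z. g z = 0 \<Longrightarrow> norm xs \<le> norm z"
proof -
  define xb where "xb k = center (\<epsilon> k)" for k
  have crit: "reg_grad (\<epsilon> k) (xb k) = 0" for k
    unfolding xb_def by (rule reg_grad_center[OF pos])
  have antimono: "\<epsilon> n \<le> \<epsilon> m" if "m \<le> n" for m n
    using that decr by (rule lift_Suc_antimono_le[rotated])
  have gap: "(norm (xb m - xb n))\<^sup>2 \<le> (norm (xb n))\<^sup>2 - (norm (xb m))\<^sup>2" if "m \<le> n" for m n
  proof -
    have le: "\<epsilon> n \<le> \<epsilon> m" using antimono[OF that] .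
    have "(\<epsilon> m + \<epsilon> n) * (norm (xb m - xb n))\<^sup>2 \<le> (\<epsilon> m - \<epsilon> n) * ((norm (xb n))\<^sup>2 - (norm (xb m))\<^sup>2)"
      by (rule critical_points_dist_sq[OF crit crit])
    \<comment> \<open>For equal parameters the centers coincide; otherwise the preceding inequality
      has a nonnegative left side and a positive factor on the right.\<close>
    moreover have "0 \<le> (norm (xb n))\<^sup>2 - (norm (xb m))\<^sup>2"
    proof (cases "\<epsilon> n = \<epsilon> m")
      case False
      have "0 \<le> (\<epsilon> m - \<epsilon> n) * ((norm (xb n))\<^sup>2 - (norm (xb m))\<^sup>2)"
        using calculation pos[of m] pos[of n]
        by (meson add_nonneg_nonneg less_imp_le mult_nonneg_nonneg order_trans zero_le_power2)
      thus ?thesis using le False by (simp add: zero_le_mult_iff)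
    qed (simp add: xb_def)
    hence "(\<epsilon> m - \<epsilon> n) * ((norm (xb n))\<^sup>2 - (norm (xb m))\<^sup>2)
        \<le> (\<epsilon> m + \<epsilon> n) * ((norm (xb n))\<^sup>2 - (norm (xb m))\<^sup>2)"
      using pos[of n] by (intro mult_right_mono) auto
    ultimately have "(\<epsilon> m + \<epsilon> n) * (norm (xb m - xb n))\<^sup>2
        \<le> (\<epsilon> m + \<epsilon> n) * ((norm (xb n))\<^sup>2 - (norm (xb m))\<^sup>2)" by linarith
    thus ?thesis using pos[of m] pos[of n] by simp
  qed
  have "incseq (\<lambda>k. (norm (xb k))\<^sup>2)"
  proof (rule incseq_SucI)
    fix k show "(norm (xb k))\<^sup>2 \<le> (norm (xb (Suc k)))\<^sup>2"
      using gap[of k "Suc k"] zero_le_power2[of "norm (xb k - xb (Suc k))"] by linarith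
  qed
  moreover have "(norm (xb k))\<^sup>2 \<le> (norm z0)\<^sup>2" for k
    using norm_center_le[OF ex pos] by (simp add: xb_def power_mono)
  ultimately have "convergent (\<lambda>k. (norm (xb k))\<^sup>2)"
    using incseq_convergent convergent_def by blast
  hence cauchy: "Cauchy (\<lambda>k. (norm (xb k))\<^sup>2)" by (rule convergent_Cauchy)
  have "Cauchy xb"
  proof (rule metric_CauchyI)
    fix e :: real assume e: "0 < e"
    obtain M where M: "\<And>m n. m \<ge> M \<Longrightarrow> n \<ge> M \<Longrightarrow> dist ((norm (xb m))\<^sup>2) ((norm (xb n))\<^sup>2) < e\<^sup>2"
      using metric_CauchyD[OF cauchy, of "e\<^sup>2"] e by auto
    have close: "dist (xb m) (xb n) < e" if "M \<le> m" "m \<le> n" for m n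
    proof -
      have "(norm (xb m - xb n))\<^sup>2 < e\<^sup>2"
        using gap[OF that(2)] M[of m n] that by (simp add: dist_real_def)
      thus ?thesis using e by (simp add: dist_norm power2_less_imp_less)
    qed
    show "\<exists>M. \<forall>m\<ge>M. \<forall>n\<ge>M. dist (xb m) (xb n) < e"
      using close by (metis dist_commute nle_le)
  qed
  then obtain xs where xs: "xb \<longlonglongrightarrow> xs" using Cauchy_convergent convergent_def by blast
  have cont: "continuous_on UNIV g" by (rule lipschitz_on_continuous_on[OF lipschitz])
  have "(\<lambda>k. reg_grad (\<epsilon> k) (xb k)) \<longlonglongrightarrow> g xs + 0 *\<^sub>R xs"
    unfolding reg_grad_def
    using continuous_on_tendsto_compose[OF cont xs] xs lim by (intro tendsto_add tendsto_scaleR) auto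
  hence gxs: "g xs = 0" using LIMSEQ_unique[OF _ tendsto_const] by (simp add: crit)
  \<comment> \<open>The limit of the distance inequality with \<open>\<nu> = 0\<close>. It contains
    both the minimality of the norm of \<open>xs\<close> and the uniqueness.\<close>
  have nearest: "(norm (xs - z))\<^sup>2 \<le> (norm z)\<^sup>2 - (norm xs)\<^sup>2" if "g z = 0" for z
  proof (rule LIMSEQ_le)
    show "(\<lambda>k. (norm (xb k - z))\<^sup>2) \<longlonglongrightarrow> (norm (xs - z))\<^sup>2" by (intro tendsto_intros xs)
    show "(\<lambda>k. (norm z)\<^sup>2 - (norm (xb k))\<^sup>2) \<longlonglongrightarrow> (norm z)\<^sup>2 - (norm xs)\<^sup>2"
      by (intro tendsto_intros xs)
    show "\<exists>N. \<forall>k\<ge>N. (norm (xb k - z))\<^sup>2 \<le> (norm z)\<^sup>2 - (norm (xb k))\<^sup>2"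
      using critical_points_dist_sq[OF crit, of 0 z] that pos by (auto simp: reg_grad_def)
  qed
  show thesis
  proof (rule that)
    show "(\<lambda>k. center (\<epsilon> k)) \<longlonglongrightarrow> xs" using xs by (simp add: xb_def[abs_def])
    show "g xs = 0" by (rule gxs)
  next
    fix z assume z: "g z = 0"
    have "(norm xs)\<^sup>2 \<le> (norm z)\<^sup>2"
      using nearest[OF z] zero_le_power2[of "norm (xs - z)"] by linarith
    thus "norm xs \<le> norm z" by (rule power2_le_imp_le) simp
    assume "norm z \<le> norm xs"
    hence "(norm z)\<^sup>2 \<le> (norm xs)\<^sup>2" by (simp add: power_mono)
    hence "(norm (xs - z))\<^sup>2 \<le> 0" using nearest[OF z] by linarith
    thus "z = xs" by simp
  qed
qed

section \<open>The energy: contraction at frozen parameters and change of parameters\<close>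

text \<open>The strong convexity bounds at \<open>x\<close> and \<open>z\<close>, weighted by
  \<open>1 - \<tau>\<close> and \<open>\<tau>\<close>, have linear parts that add up to the product
  of the gradient with the very vector measured by the kinetic term. The gradient step then
  completes the square.\<close>

lemma estimate_sequence_step:
  assumes s: "0 < s" "s * (L + \<mu>) \<le> 1" and \<tau>: "0 \<le> \<tau>" "\<tau> \<le> 1" and \<mu>: "0 \<le> \<mu>"
    and crit: "reg_grad \<mu> z = 0" and x': "x' = y - s *\<^sub>R reg_grad \<mu> y"
  shows "reg \<mu> x' - reg \<mu> z + (norm (x' - x + \<tau> *\<^sub>R (x - z)))\<^sup>2 / (2 * s)
    \<le> (1 - \<tau>) * (reg \<mu> x - reg \<mu> z) + (norm (y - x + \<tau> *\<^sub>R (x - z)))\<^sup>2 / (2 * s)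
      - \<mu> / 2 * (\<tau> * (1 - \<tau>)) * (norm (x - z))\<^sup>2"
proof -
  define G w e r where "G = reg_grad \<mu> y" and "w = y - x + \<tau> *\<^sub>R (x - z)"
    and "e = y - x" and "r = x - z"
  have step: "reg \<mu> x' \<le> reg \<mu> y - s / 2 * (norm G)\<^sup>2"
    unfolding x' G_def by (rule reg_gradient_step[OF s])
  have at_x: "reg \<mu> x \<ge> reg \<mu> y - G \<bullet> e + \<mu> / 2 * (norm e)\<^sup>2"
    using reg_strongly_convex[of \<mu> y "- e"]
    unfolding norm_minus_cancel inner_minus_right by (simp add: G_def e_def)
  have at_z: "reg \<mu> z \<ge> reg \<mu> y - G \<bullet> (e + r) + \<mu> / 2 * (norm (e + r))\<^sup>2"
    using reg_strongly_convex[of \<mu> y "- (e + r)"] 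
    unfolding norm_minus_cancel inner_minus_right by (simp add: G_def e_def r_def)
  have "(1 - \<tau>) * reg \<mu> x \<ge> (1 - \<tau>) * (reg \<mu> y - G \<bullet> e + \<mu> / 2 * (norm e)\<^sup>2)"
    using at_x \<tau> by (intro mult_left_mono) auto
  moreover have "\<tau> * reg \<mu> z \<ge> \<tau> * (reg \<mu> y - G \<bullet> (e + r) + \<mu> / 2 * (norm (e + r))\<^sup>2)"
    using at_z \<tau> by (intro mult_left_mono) auto
  \<comment> \<open>The quadratic terms combine by the variance identity for the points
    \<open>e\<close> and \<open>e + r\<close> with weights \<open>1 - \<tau>\<close> and
    \<open>\<tau>\<close>.\<close>
  ultimately have mix: "(1 - \<tau>) * reg \<mu> x + \<tau> * reg \<mu> z \<ge> reg \<mu> y - G \<bullet> (e + \<tau> *\<^sub>R r)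
      + \<mu> / 2 * ((norm (e + \<tau> *\<^sub>R r))\<^sup>2 + \<tau> * (1 - \<tau>) * (norm r)\<^sup>2)"
    unfolding norm_sq_add
    by (simp add: inner_add_right power_mult_distrib power2_eq_square[of \<tau>] field_simps)
  have "\<mu> / 2 * (norm (e + \<tau> *\<^sub>R r))\<^sup>2 \<ge> 0" using \<mu> by simp
  with mix have mix': "(1 - \<tau>) * reg \<mu> x + \<tau> * reg \<mu> z \<ge> reg \<mu> y - G \<bullet> w
      + \<mu> / 2 * (\<tau> * (1 - \<tau>)) * (norm r)\<^sup>2"
    unfolding w_def e_def r_def by (simp add: distrib_left mult.assoc)
  have "x' - x + \<tau> *\<^sub>R (x - z) = w + (- s) *\<^sub>R G" by (simp add: x' w_def G_def)
  hence "(norm (x' - x + \<tau> *\<^sub>R (x - z)))\<^sup>2 = (norm w)\<^sup>2 - 2 * s * (G \<bullet> w) + s\<^sup>2 * (norm G)\<^sup>2"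
    by (simp only: norm_sq_add[of w]) (simp add: power_mult_distrib inner_commute)
  \<comment> \<open>The last term is exactly the decrease provided by \<open>step\<close>, and
    \<open>G \<bullet> w\<close> cancels against \<open>mix'\<close>.\<close>
  hence "(norm (x' - x + \<tau> *\<^sub>R (x - z)))\<^sup>2 / (2 * s) = (norm w)\<^sup>2 / (2 * s) - G \<bullet> w + s / 2 * (norm G)\<^sup>2"
    using s by (simp add: field_simps power2_eq_square)
  thus ?thesis using step mix' unfolding w_def[symmetric] r_def by (simp add: algebra_simps)
qed

text \<open>Here \<open>x\<close> is the previous and \<open>x'\<close> the current iterate; the
  anchoring term uses the previous one.\<close>

definition energy :: "real \<Rightarrow> real \<Rightarrow> real \<Rightarrow> 'a \<Rightarrow> 'a \<Rightarrow> real"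
  where "energy s \<mu> \<tau> x x' = reg \<mu> x' - reg \<mu> (center \<mu>)
    + (norm (x' - x + \<tau> *\<^sub>R (x - center \<mu>)))\<^sup>2 / (2 * s)"

lemma energy_bounds:
  assumes "0 < \<mu>" "0 < s"
  shows "0 \<le> energy s \<mu> \<tau> x x'" "reg \<mu> x' - reg \<mu> (center \<mu>) \<le> energy s \<mu> \<tau> x x'"
    "(norm (x' - center \<mu>))\<^sup>2 \<le> 2 * energy s \<mu> \<tau> x x' / \<mu>"
    "(norm (x' - x + \<tau> *\<^sub>R (x - center \<mu>)))\<^sup>2 \<le> 2 * s * energy s \<mu> \<tau> x x'"
proof -
  define v where "v = (norm (x' - x + \<tau> *\<^sub>R (x - center \<mu>)))\<^sup>2 / (2 * s)"
  have v: "0 \<le> v" using assms by (simp add: v_def)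
  have gap: "reg \<mu> x' - reg \<mu> (center \<mu>) \<ge> \<mu> / 2 * (norm (x' - center \<mu>))\<^sup>2"
    using reg_above_center[OF reg_grad_center[OF assms(1)], of x'] by simp
  have sq: "0 \<le> \<mu> / 2 * (norm (x' - center \<mu>))\<^sup>2" using assms by simp
  have E: "energy s \<mu> \<tau> x x' = reg \<mu> x' - reg \<mu> (center \<mu>) + v"
    by (simp add: energy_def v_def)
  show "0 \<le> energy s \<mu> \<tau> x x'" "reg \<mu> x' - reg \<mu> (center \<mu>) \<le> energy s \<mu> \<tau> x x'"
    using v gap sq E by auto
  have "\<mu> / 2 * (norm (x' - center \<mu>))\<^sup>2 \<le> energy s \<mu> \<tau> x x'"
    using v gap E by linarith
  thus "(norm (x' - center \<mu>))\<^sup>2 \<le> 2 * energy s \<mu> \<tau> x x' / \<mu>"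
    using assms by (simp add: field_simps)
  have "v \<le> energy s \<mu> \<tau> x x'" using gap sq E by linarith
  thus "(norm (x' - x + \<tau> *\<^sub>R (x - center \<mu>)))\<^sup>2 \<le> 2 * s * energy s \<mu> \<tau> x x'"
    using assms by (simp add: v_def field_simps)
qed

text \<open>Chains \<open>inertial_norm_bound\<close> with \<open>estimate_sequence_step\<close>.
  The error proportional to the squared distance from the center is absorbed by the strong convexity
  gain \<open>\<mu> / 2 * (\<tau> * (1 - \<tau>))\<close>, which is possible because
  \<open>\<tau>\<^sup>2\<close> is small against \<open>\<mu>\<close>.\<close>

lemma energy_step:
  assumes s: "0 < s" "s * (L + \<mu>) \<le> 1" and \<mu>: "0 < \<mu>" and \<tau>: "0 < \<tau>" "\<tau> \<le> 1 / 2"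
    and b: "b = (1 - \<tau>) * \<beta>" "0 \<le> \<beta>" "\<beta> \<le> 1 - \<tau>"
    and K: "\<bar>\<tau> * (1 - \<beta>) - c\<bar> \<le> K * \<tau>\<^sup>2" "\<bar>c\<bar> \<le> K * \<tau>\<^sup>2" "4 * K\<^sup>2 * \<tau>\<^sup>2 \<le> s * \<mu>"
    and z0: "g z0 = 0"
    and y: "y = x + b *\<^sub>R (x - x0) - c *\<^sub>R x" and x': "x' = y - s *\<^sub>R reg_grad \<mu> y"
  shows "energy s \<mu> \<tau> x x' \<le> (1 - \<tau>) * energy s \<mu> \<tau> x0 x + K\<^sup>2 * \<tau> ^ 3 * (norm z0)\<^sup>2 / s"
proof -
  define z r d R where "z = center \<mu>" and "r = x - z" and "d = x - x0" and "R = norm z0"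
  have crit: "reg_grad \<mu> z = 0" unfolding z_def by (rule reg_grad_center[OF \<mu>])
  have "norm z \<le> R" unfolding z_def R_def by (rule norm_center_le[OF z0 \<mu>])
  note inertial_norm_bound[OF \<tau>(1) _ b K(1,2) this, of d r]
  moreover have "y - x + \<tau> *\<^sub>R (x - z) = b *\<^sub>R d - c *\<^sub>R (r + z) + \<tau> *\<^sub>R r"
    by (simp add: y r_def d_def)
  moreover have "(1 - \<tau>) *\<^sub>R d + \<tau> *\<^sub>R r = x - x0 + \<tau> *\<^sub>R (x0 - z)"
    by (simp add: r_def d_def algebra_simps)
  ultimately have "(norm (y - x + \<tau> *\<^sub>R (x - z)))\<^sup>2
      \<le> (1 - \<tau>) * (norm (x - x0 + \<tau> *\<^sub>R (x0 - z)))\<^sup>2 + 2 * K\<^sup>2 * \<tau> ^ 3 * ((norm r)\<^sup>2 + R\<^sup>2)"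
    using \<tau> by simp
  hence "(norm (y - x + \<tau> *\<^sub>R (x - z)))\<^sup>2 / (2 * s)
      \<le> ((1 - \<tau>) * (norm (x - x0 + \<tau> *\<^sub>R (x0 - z)))\<^sup>2 + 2 * K\<^sup>2 * \<tau> ^ 3 * ((norm r)\<^sup>2 + R\<^sup>2)) / (2 * s)"
    using s by (intro divide_right_mono) auto
  also have "\<dots> = (1 - \<tau>) * ((norm (x - x0 + \<tau> *\<^sub>R (x0 - z)))\<^sup>2 / (2 * s))
      + K\<^sup>2 * \<tau> ^ 3 / s * (norm r)\<^sup>2 + K\<^sup>2 * \<tau> ^ 3 * R\<^sup>2 / s"
    using s by (simp add: field_simps)
  finally have w: "(norm (y - x + \<tau> *\<^sub>R (x - z)))\<^sup>2 / (2 * s) \<le> \<dots>" .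
  have "K\<^sup>2 * \<tau> ^ 3 / s \<le> \<mu> / 2 * (\<tau> * (1 - \<tau>))"
  proof -
    have "\<tau> * (4 * K\<^sup>2 * \<tau>\<^sup>2) \<le> \<tau> * (s * \<mu>)" using K \<tau> by (intro mult_left_mono) auto
    also have "\<dots> \<le> \<tau> * (s * \<mu>) * (2 * (1 - \<tau>))"
      using \<tau> \<mu> s mult_left_mono[of 1 "2 * (1 - \<tau>)" "\<tau> * (s * \<mu>)"] by simp
    finally show ?thesis using s by (simp add: field_simps power2_eq_square power3_eq_cube)
  qed
  hence "K\<^sup>2 * \<tau> ^ 3 / s * (norm r)\<^sup>2 \<le> \<mu> / 2 * (\<tau> * (1 - \<tau>)) * (norm r)\<^sup>2"
    by (rule mult_right_mono) simp
  thus ?thesis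
    using w estimate_sequence_step[OF s less_imp_le[OF \<tau>(1)] _ less_imp_le[OF \<mu>] crit x', of x] \<tau>
    unfolding energy_def z_def[symmetric] r_def[symmetric] R_def[symmetric] distrib_left
    by linarith
qed

text \<open>The vector \<open>v\<close> collects the changes of \<open>\<tau>\<close> and of the
  center in the kinetic term and has norm at most
  \<open>2 * \<tau> * \<delta> * (norm r + R)\<close>. The factor
  \<open>1 / (1 - \<tau> / 2)\<close> spends half of the contraction won in
  \<open>energy_step\<close>.\<close>

lemma energy_shift:
  assumes s: "0 < s" and \<mu>: "0 < \<mu>'" "\<mu>' \<le> \<mu>" "\<mu> - \<mu>' \<le> \<mu> * \<delta>" and \<delta>: "\<delta> \<le> 1"
    and \<tau>: "0 < \<tau>" "\<tau> \<le> 1 / 2" "0 < \<tau>'" "\<bar>\<tau>' - \<tau>\<bar> \<le> \<tau> * \<delta>" and z0: "g z0 = 0"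
  shows "energy s \<mu>' \<tau>' x x' \<le> energy s \<mu> \<tau> x x' / (1 - \<tau> / 2) + (\<mu> - \<mu>') / 2 * (norm z0)\<^sup>2
    + 8 * \<tau> * \<delta>\<^sup>2 / s * ((norm (x - center \<mu>))\<^sup>2 + (norm z0)\<^sup>2)"
proof -
  define z z' r R where "z = center \<mu>" and "z' = center \<mu>'" and "r = x - z" and "R = norm z0"
  define u v where "u = x' - x + \<tau> *\<^sub>R r" and "v = (\<tau>' - \<tau>) *\<^sub>R r + \<tau>' *\<^sub>R (z - z')"
  have \<mu>0: "0 < \<mu>" using \<mu> by simp
  have crit: "reg_grad \<mu> z = 0" "reg_grad \<mu>' z' = 0"
    unfolding z_def z'_def using \<mu>0 \<mu> by (auto intro: reg_grad_center)
  have z'R: "norm z' \<le> R" unfolding z'_def R_def by (rule norm_center_le[OF z0 \<mu>(1)])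
  have R0: "0 \<le> R" by (simp add: R_def)
  have \<delta>0: "0 \<le> \<delta>" using \<tau> by (smt (verit) zero_le_mult_iff)
  have "\<mu> * norm (z - z') \<le> (\<mu> - \<mu>') * norm z'"
    by (rule critical_points_dist[OF crit \<mu>(2)])
  also have "\<dots> \<le> (\<mu> * \<delta>) * R" using \<mu> \<mu>0 \<delta>0 z'R by (intro mult_mono) auto
  finally have zz: "norm (z - z') \<le> \<delta> * R" using \<mu>0 by simp
  have "\<tau> * \<delta> \<le> \<tau> * 1" using \<tau> \<delta> by (intro mult_left_mono) auto
  hence \<tau>': "\<tau>' \<le> 2 * \<tau>" using \<tau> by linarith
  have "norm v \<le> norm ((\<tau>' - \<tau>) *\<^sub>R r) + norm (\<tau>' *\<^sub>R (z - z'))"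
    unfolding v_def by (rule norm_triangle_ineq)
  also have "\<dots> \<le> \<tau> * \<delta> * norm r + 2 * \<tau> * (\<delta> * R)"
    unfolding norm_scaleR using \<tau> \<tau>' zz by (intro add_mono mult_mono) auto
  also have "\<dots> \<le> 2 * \<tau> * \<delta> * (norm r + R)"
    using \<tau> \<delta>0 by (simp add: algebra_simps)
  finally have "(norm v)\<^sup>2 \<le> (2 * \<tau> * \<delta> * (norm r + R))\<^sup>2" by (intro power_mono) auto
  also have "\<dots> = 4 * \<tau>\<^sup>2 * \<delta>\<^sup>2 * (norm r + R)\<^sup>2" by (simp add: power_mult_distrib)
  also have "\<dots> \<le> 4 * \<tau>\<^sup>2 * \<delta>\<^sup>2 * (2 * ((norm r)\<^sup>2 + R\<^sup>2))"
    using zero_le_power2[of "norm r - R"]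
    by (intro mult_left_mono) (simp add: power2_eq_square algebra_simps, simp)
  finally have "(norm v)\<^sup>2 / (s * \<tau>) \<le> 4 * \<tau>\<^sup>2 * \<delta>\<^sup>2 * (2 * ((norm r)\<^sup>2 + R\<^sup>2)) / (s * \<tau>)"
    using s \<tau> by (intro divide_right_mono) auto
  also have "\<dots> = 8 * \<tau> * \<delta>\<^sup>2 / s * ((norm r)\<^sup>2 + R\<^sup>2)"
    using s \<tau> by (simp add: field_simps power2_eq_square)
  finally have v: "(norm v)\<^sup>2 / (s * \<tau>) \<le> \<dots>" .
  have "x' - x + \<tau>' *\<^sub>R (x - z') = u + v"
    by (simp add: u_def v_def r_def algebra_simps)
  moreover have "(norm (u + v))\<^sup>2 / (2 * s) \<le> ((norm u)\<^sup>2 / (1 - \<tau> / 2) + (norm v)\<^sup>2 / (\<tau> / 2)) / (2 * s)"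
    using norm_sq_add_le[of "\<tau> / 2" u v] \<tau> s by (intro divide_right_mono) auto
  moreover have "\<dots> = (norm u)\<^sup>2 / (2 * s) / (1 - \<tau> / 2) + (norm v)\<^sup>2 / (s * \<tau>)"
    using s \<tau> by (simp add: add_divide_distrib mult.commute)
  ultimately have kin: "(norm (x' - x + \<tau>' *\<^sub>R (x - z')))\<^sup>2 / (2 * s)
      \<le> (norm u)\<^sup>2 / (2 * s) / (1 - \<tau> / 2) + 8 * \<tau> * \<delta>\<^sup>2 / s * ((norm r)\<^sup>2 + R\<^sup>2)"
    using v by simp
  have above: "reg \<mu> z \<le> reg \<mu> w" for w
    using reg_above_center[OF crit(1), of w] \<mu>0 by (smt (verit) half_gt_zero mult_nonneg_nonneg zero_le_power2)
  \<comment> \<open>The change at \<open>x'\<close> has a favourable sign; only the change at the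
    new center, whose norm is at most \<open>R\<close>, is paid for.\<close>
  have "reg \<mu>' x' - reg \<mu>' z' = reg \<mu> x' - reg \<mu> z' - (\<mu> - \<mu>') / 2 * (norm x')\<^sup>2 + (\<mu> - \<mu>') / 2 * (norm z')\<^sup>2"
    by (simp add: reg_def field_simps)
  also have "\<dots> \<le> reg \<mu> x' - reg \<mu> z - 0 + (\<mu> - \<mu>') / 2 * R\<^sup>2"
    using above[of z'] \<mu> z'R by (intro add_mono diff_mono mult_left_mono power_mono) auto
  \<comment> \<open>The potential part is nonnegative, so it may carry the factor of the kinetic
    part and the whole energy is scaled at once.\<close>
  also have "reg \<mu> x' - reg \<mu> z \<le> (reg \<mu> x' - reg \<mu> z) / (1 - \<tau> / 2)"
    using above[of x'] \<tau> by (simp add: le_divide_eq mult_le_cancel_left2 algebra_simps)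
  finally have "reg \<mu>' x' - reg \<mu>' z' \<le> (reg \<mu> x' - reg \<mu> z) / (1 - \<tau> / 2) + (\<mu> - \<mu>') / 2 * R\<^sup>2"
    by simp
  thus ?thesis using kin
    unfolding energy_def z_def[symmetric] z'_def[symmetric] r_def[symmetric] R_def[symmetric] u_def[symmetric]
    by (simp add: add_divide_distrib)
qed

text \<open>Budget of the contraction \<open>1 - \<tau>\<close>: \<open>\<tau> / 2\<close> pays for
  the Young inequality in \<open>energy_shift\<close>, \<open>\<tau> / 4\<close> for the drift term
  at \<open>x\<close>, and \<open>\<tau> / 8\<close> for dividing by \<open>\<mu>'\<close> instead
  of \<open>\<mu>\<close>; \<open>\<tau> / 8\<close> is left.\<close>

lemma energy_recursion:
  assumes s: "0 < s" "s * (L + \<mu>) \<le> 1" and \<mu>: "0 < \<mu>'" "\<mu>' \<le> \<mu>" "\<mu> - \<mu>' \<le> \<mu> * \<delta>"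
    and \<delta>: "\<delta> \<le> \<tau> / 16" "64 * \<delta>\<^sup>2 \<le> s * \<mu>"
    and \<tau>: "0 < \<tau>" "\<tau> \<le> 1 / 2" "0 < \<tau>'" "\<bar>\<tau>' - \<tau>\<bar> \<le> \<tau> * \<delta>"
    and b: "b = (1 - \<tau>) * \<beta>" "0 \<le> \<beta>" "\<beta> \<le> 1 - \<tau>"
    and K: "\<bar>\<tau> * (1 - \<beta>) - c\<bar> \<le> K * \<tau>\<^sup>2" "\<bar>c\<bar> \<le> K * \<tau>\<^sup>2" "4 * K\<^sup>2 * \<tau>\<^sup>2 \<le> s * \<mu>"
    and z0: "g z0 = 0"
    and y: "y = x + b *\<^sub>R (x - x0) - c *\<^sub>R x" and x': "x' = y - s *\<^sub>R reg_grad \<mu> y"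
  shows "energy s \<mu>' \<tau>' x x' / \<mu>' \<le> (1 - \<tau> / 8) * (energy s \<mu> \<tau> x0 x / \<mu>)
    + \<tau> / 8 * ((32 * K\<^sup>2 / s * (\<tau>\<^sup>2 / \<mu>) + 8 * (\<delta> / \<tau>) + 128 / s * (\<delta>\<^sup>2 / \<mu>)) * (norm z0)\<^sup>2)"
proof -
  define E N where "E = energy s \<mu> \<tau> x0 x" and "N = (norm z0)\<^sup>2"
  define S where "S = 2 * K\<^sup>2 * \<tau> ^ 3 / s + \<mu> * \<delta> / 2 + 8 * \<tau> * \<delta>\<^sup>2 / s"
  have \<mu>0: "0 < \<mu>" using \<mu> by simp
  have N0: "0 \<le> N" by (simp add: N_def)
  have E0: "0 \<le> E" unfolding E_def by (rule energy_bounds[OF \<mu>0 s(1)])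
  have \<delta>0: "0 \<le> \<delta>" using \<tau> by (smt (verit) zero_le_mult_iff)
  have S0: "0 \<le> S" unfolding S_def using s \<tau> \<mu>0 \<delta>0 by simp
  have \<delta>1: "\<delta> \<le> 1" using \<delta> \<tau> by simp
  have half: "1 \<le> 2 * (1 - \<tau> / 2)" "0 < 1 - \<tau> / 2" using \<tau> by auto
  have "energy s \<mu> \<tau> x x' / (1 - \<tau> / 2) \<le> ((1 - \<tau>) * E + K\<^sup>2 * \<tau> ^ 3 * N / s) / (1 - \<tau> / 2)"
    unfolding E_def N_def
    using energy_step[OF s \<mu>0 \<tau>(1,2) b K z0 y x'] half by (intro divide_right_mono) auto
  also have "\<dots> \<le> (1 - \<tau> / 2) * E + 2 * (K\<^sup>2 * \<tau> ^ 3 * N / s)"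
  proof -
    have "1 * (K\<^sup>2 * \<tau> ^ 3 * N / s) \<le> 2 * (1 - \<tau> / 2) * (K\<^sup>2 * \<tau> ^ 3 * N / s)"
      using half s \<tau> N0 by (intro mult_right_mono) auto
    moreover have "(1 - \<tau>) * E \<le> (1 - \<tau> / 2) * (1 - \<tau> / 2) * E"
      using E0 by (intro mult_right_mono) (auto simp: algebra_simps)
    ultimately have "(1 - \<tau>) * E + K\<^sup>2 * \<tau> ^ 3 * N / s
        \<le> ((1 - \<tau> / 2) * E + 2 * (K\<^sup>2 * \<tau> ^ 3 * N / s)) * (1 - \<tau> / 2)"
      by (simp only: distrib_right) (simp only: ac_simps)
    thus ?thesis using half by (simp add: pos_divide_le_eq)
  qed
  finally have one: "energy s \<mu> \<tau> x x' / (1 - \<tau> / 2) \<le> (1 - \<tau> / 2) * E + 2 * K\<^sup>2 * \<tau> ^ 3 / s * N" by simp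
  have "8 * \<tau> * \<delta>\<^sup>2 / s * (norm (x - center \<mu>))\<^sup>2 \<le> 8 * \<tau> * \<delta>\<^sup>2 / s * (2 * E / \<mu>)"
    unfolding E_def using energy_bounds(3)[OF \<mu>0 s(1)] s \<tau> by (intro mult_left_mono) auto
  \<comment> \<open>This is the source of the constant 64 in the hypothesis on
    \<open>\<delta>\<close>.\<close>
  also have "\<dots> = \<tau> / 4 * (64 * \<delta>\<^sup>2 / (s * \<mu>)) * E" by simp
  also have "\<dots> \<le> \<tau> / 4 * 1 * E"
    using \<delta> s \<mu>0 \<tau> E0 by (intro mult_right_mono mult_left_mono) (auto simp: divide_le_eq)
  finally have two: "8 * \<tau> * \<delta>\<^sup>2 / s * (norm (x - center \<mu>))\<^sup>2 \<le> \<tau> / 4 * E" by simp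
  have three: "(\<mu> - \<mu>') / 2 * N \<le> \<mu> * \<delta> / 2 * N"
    using \<mu> N0 by (intro mult_right_mono) auto
  have "energy s \<mu>' \<tau>' x x' \<le> energy s \<mu> \<tau> x x' / (1 - \<tau> / 2) + (\<mu> - \<mu>') / 2 * N
    + (8 * \<tau> * \<delta>\<^sup>2 / s * (norm (x - center \<mu>))\<^sup>2 + 8 * \<tau> * \<delta>\<^sup>2 / s * N)"
    using energy_shift[OF s(1) \<mu> \<delta>1 \<tau> z0, of x x'] by (simp add: N_def distrib_left)
  also have "\<dots> \<le> ((1 - \<tau> / 2) * E + 2 * K\<^sup>2 * \<tau> ^ 3 / s * N) + \<mu> * \<delta> / 2 * N
      + (\<tau> / 4 * E + 8 * \<tau> * \<delta>\<^sup>2 / s * N)"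
    using one two three by linarith
  also have "\<dots> = (1 - \<tau> / 4) * E + S * N" by (simp add: S_def algebra_simps)
  finally have main: "energy s \<mu>' \<tau>' x x' \<le> (1 - \<tau> / 4) * E + S * N" .
  have ratio: "1 / \<mu>' \<le> (1 + \<tau> / 8) / \<mu>"
  proof -
    \<comment> \<open>The product is \<open>1 + \<tau> / 16 - \<tau>\<^sup>2 / 128\<close>; hence
      the bound \<open>\<tau> / 16\<close> imposed on \<open>\<delta>\<close>.\<close>
    have "1 \<le> (1 + \<tau> / 8) * (1 - \<tau> / 16)" using \<tau> 
      using mult_left_mono[of \<tau> "1/2" \<tau>] by (simp add: algebra_simps)
    also have "\<dots> \<le> (1 + \<tau> / 8) * (1 - \<delta>)" using \<delta> \<tau> by (intro mult_left_mono) auto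
    finally have "\<mu> * 1 \<le> \<mu> * ((1 + \<tau> / 8) * (1 - \<delta>))" using \<mu>0 by (intro mult_left_mono) auto
    also have "\<dots> = (1 + \<tau> / 8) * (\<mu> - \<mu> * \<delta>)" by (simp add: algebra_simps)
    also have "\<dots> \<le> (1 + \<tau> / 8) * \<mu>'" using \<mu> \<tau> by (intro mult_left_mono) auto
    finally show ?thesis using \<mu> \<mu>0 by (simp add: field_simps)
  qed
  have "energy s \<mu>' \<tau>' x x' / \<mu>' \<le> ((1 - \<tau> / 4) * E + S * N) * (1 / \<mu>')"
    using main \<mu> by (simp add: divide_right_mono)
  also have "\<dots> \<le> ((1 - \<tau> / 4) * E + S * N) * ((1 + \<tau> / 8) / \<mu>)"
    using ratio \<tau> E0 S0 N0 by (intro mult_left_mono) auto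
  also have "\<dots> = (1 - \<tau> / 4) * (1 + \<tau> / 8) * (E / \<mu>) + (1 + \<tau> / 8) * (S * N / \<mu>)"
    by (simp add: algebra_simps add_divide_distrib)
  also have "\<dots> \<le> (1 - \<tau> / 8) * (E / \<mu>) + 2 * (S * N / \<mu>)"
    using \<tau> E0 S0 N0 \<mu>0 by (intro add_mono mult_right_mono) (auto simp: algebra_simps)
  also have "2 * (S * N / \<mu>)
      = \<tau> / 8 * ((32 * K\<^sup>2 / s * (\<tau>\<^sup>2 / \<mu>) + 8 * (\<delta> / \<tau>) + 128 / s * (\<delta>\<^sup>2 / \<mu>)) * N)"
    unfolding S_def using \<tau> \<mu>0 s by (simp add: field_simps power2_eq_square power3_eq_cube)
  finally show ?thesis unfolding E_def N_def .
qed

end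

subsection \<open>The Tikhonov-regularised inertial gradient method\<close>

text \<open>Here \<open>b k\<close> is the coefficient used in step \<open>k\<close>, i.e. \<open>b\<^sub>k\<^sub>-\<^sub>1\<close> in the theorem, and \<open>\<delta> k\<close> is an
  upper bound for the relative variation of \<open>\<epsilon>\<close> and \<open>\<tau>\<close> from \<open>k\<close> to \<open>k + 1\<close>.\<close>

locale tikhonov_inertial = smooth_convex f g L
  for f :: "'a :: {real_inner, complete_space} \<Rightarrow> real" and g L +
  fixes s :: real and \<epsilon> \<tau> \<delta> b c :: "nat \<Rightarrow> real" and x y :: "nat \<Rightarrow> 'a" and z0 :: 'a
  assumes s: "0 < s" "s * L < 1" and z0: "g z0 = 0"
    and \<epsilon>_pos: "\<And>k. k \<ge> 1 \<Longrightarrow> 0 < \<epsilon> k" and \<epsilon>_decr: "\<And>k. k \<ge> 1 \<Longrightarrow> \<epsilon> (Suc k) \<le> \<epsilon> k"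
    and \<epsilon>_lim: "\<epsilon> \<longlonglongrightarrow> 0"
    and \<tau>_pos: "\<And>k. k \<ge> 1 \<Longrightarrow> 0 < \<tau> k" and \<tau>_lim: "\<tau> \<longlonglongrightarrow> 0" and \<tau>_sum: "\<not> summable \<tau>"
    and \<tau>_\<epsilon>: "(\<lambda>k. (\<tau> k)\<^sup>2 / \<epsilon> k) \<longlonglongrightarrow> 0"
    and b_lim: "(\<lambda>k. (1 - b k) / \<tau> k) \<longlonglongrightarrow> 3"
    and c_bound: "c \<in> O(\<lambda>k. (\<tau> k)\<^sup>2)"
    and \<delta>_\<epsilon>: "eventually (\<lambda>k. \<epsilon> k - \<epsilon> (Suc k) \<le> \<epsilon> k * \<delta> k) sequentially"
    and \<delta>_\<tau>: "eventually (\<lambda>k. \<bar>\<tau> (Suc k) - \<tau> k\<bar> \<le> \<tau> k * \<delta> k) sequentially"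
    and \<delta>_small: "(\<lambda>k. \<delta> k / \<tau> k) \<longlonglongrightarrow> 0" "(\<lambda>k. (\<delta> k)\<^sup>2 / \<epsilon> k) \<longlonglongrightarrow> 0"
    and y_step: "\<And>k. k \<ge> 1 \<Longrightarrow> y k = x k + b k *\<^sub>R (x k - x (k - 1)) - c k *\<^sub>R x k"
    and x_step: "\<And>k. k \<ge> 1 \<Longrightarrow> x (Suc k) = y k - s *\<^sub>R reg_grad (\<epsilon> k) (y k)"
begin

text \<open>Index \<open>0\<close> is excluded since \<open>x (k - 1)\<close> makes no sense there and \<open>\<epsilon> 0\<close> need not be positive.\<close>

definition \<E> :: "nat \<Rightarrow> real"
  where "\<E> k = (if k = 0 then 0 else energy s (\<epsilon> k) (\<tau> k) (x (k - 1)) (x k))"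

lemma relative_energy_tendsto_0: "(\<lambda>k. \<E> k / \<epsilon> k) \<longlonglongrightarrow> 0"
proof -
  obtain Kc where Kc: "0 < Kc" "eventually (\<lambda>k. norm (c k) \<le> Kc * norm ((\<tau> k)\<^sup>2)) sequentially"
    using landau_o.bigE[OF c_bound] by blast
  \<comment> \<open>The 6 bounds \<open>(1 - \<beta>) / \<tau> k\<close> and \<open>Kc\<close>
    bounds \<open>\<bar>c k\<bar> / (\<tau> k)\<^sup>2\<close>.\<close>
  define K where "K = 6 + Kc"
  define \<sigma> where "\<sigma> k = (32 * K\<^sup>2 / s * ((\<tau> k)\<^sup>2 / \<epsilon> k) + 8 * (\<delta> k / \<tau> k)
      + 128 / s * ((\<delta> k)\<^sup>2 / \<epsilon> k)) * (norm z0)\<^sup>2" for k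
  \<comment> \<open>The strict inequality \<open>s * L < 1\<close> leaves room for the
    regularisation in the step size condition.\<close>
  have "(\<lambda>k. s * (L + \<epsilon> k)) \<longlonglongrightarrow> s * (L + 0)" by (intro tendsto_intros \<epsilon>_lim)
  hence ev1: "eventually (\<lambda>k. s * (L + \<epsilon> k) < 1) sequentially"
    using s by (intro order_tendstoD(2)) auto
  have sq: "0 < s / 64" "0 < s / (4 * K\<^sup>2)" using s Kc by (auto simp: K_def)
  have "eventually (\<lambda>k. \<E> (Suc k) / \<epsilon> (Suc k) \<le> (1 - \<tau> k / 8) * (\<E> k / \<epsilon> k) + \<tau> k / 8 * \<sigma> k) sequentially"
    using ev1 eventually_ge_at_top[of "1::nat"] \<delta>_\<epsilon> \<delta>_\<tau> Kc(2)
      order_tendstoD(2)[OF \<delta>_small(1), of "1/16", simplified] order_tendstoD(2)[OF \<delta>_small(2) sq(1)]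
      order_tendstoD(2)[OF \<tau>_\<epsilon> sq(2)] order_tendstoD(2)[OF \<tau>_lim, of "1/4", simplified]
      order_tendstoD(1)[OF b_lim, of 2, simplified] order_tendstoD(2)[OF b_lim, of 4, simplified]
  proof eventually_elim
    case (elim k)
    define \<beta> where "\<beta> = b k / (1 - \<tau> k)"
    have k: "0 < \<tau> k" "\<tau> k < 1 / 4" "0 < \<epsilon> k" "0 < \<tau> (Suc k)" "0 < \<epsilon> (Suc k)" "\<epsilon> (Suc k) \<le> \<epsilon> k"
      using elim \<tau>_pos \<epsilon>_pos \<epsilon>_decr by auto
    \<comment> \<open>The limit 3 of \<open>(1 - b k) / \<tau> k\<close> lies between 2 and 4.
      Dividing by \<open>1 - \<tau> k\<close> then places \<open>\<beta>\<close> between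
      \<open>1 - 6 * \<tau> k\<close> and \<open>1 - \<tau> k\<close>.\<close>
    have b: "1 - 4 * \<tau> k < b k" "b k < 1 - 2 * \<tau> k" using elim k by (simp_all add: field_simps)
    have b\<beta>: "b k = (1 - \<tau> k) * \<beta>" using k by (simp add: \<beta>_def)
    have \<beta>0: "0 \<le> \<beta>" unfolding \<beta>_def using b k by simp
    have "(1 - \<tau> k) * (1 - \<tau> k) = 1 - 2 * \<tau> k + \<tau> k * \<tau> k" by (simp add: algebra_simps)
    hence "b k \<le> (1 - \<tau> k) * (1 - \<tau> k)" using b zero_le_square[of "\<tau> k"] by linarith
    hence \<beta>1: "\<beta> \<le> 1 - \<tau> k" unfolding \<beta>_def using k by (simp add: divide_le_eq)
    have "1 - \<beta> \<le> 6 * \<tau> k"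
    proof -
      have "(1 - 6 * \<tau> k) * (1 - \<tau> k) \<le> 1 - 4 * \<tau> k"
        using mult_left_mono[of "6 * \<tau> k" 3 "\<tau> k"] k by (simp add: algebra_simps)
      hence "1 - 6 * \<tau> k \<le> b k / (1 - \<tau> k)" using b k by (simp add: le_divide_eq)
      thus ?thesis by (simp add: \<beta>_def)
    qed
    hence up: "\<tau> k * (1 - \<beta>) \<le> 6 * (\<tau> k)\<^sup>2"
      using mult_left_mono[of "1 - \<beta>" "6 * \<tau> k" "\<tau> k"] k by (simp add: power2_eq_square)
    have lo: "0 \<le> \<tau> k * (1 - \<beta>)" using \<beta>1 k by (intro mult_nonneg_nonneg) auto
    have c: "\<bar>c k\<bar> \<le> Kc * (\<tau> k)\<^sup>2" using elim by simp
    have K1: "\<bar>\<tau> k * (1 - \<beta>) - c k\<bar> \<le> K * (\<tau> k)\<^sup>2"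
      using up lo c by (simp add: K_def distrib_right abs_le_iff)
    have "K * (\<tau> k)\<^sup>2 = Kc * (\<tau> k)\<^sup>2 + 6 * (\<tau> k)\<^sup>2" by (simp add: K_def distrib_right)
    hence K2: "\<bar>c k\<bar> \<le> K * (\<tau> k)\<^sup>2" using c zero_le_power2[of "\<tau> k"] by linarith
    have K3: "4 * K\<^sup>2 * (\<tau> k)\<^sup>2 \<le> s * \<epsilon> k"
      using elim k s Kc by (simp add: K_def field_simps)
    have \<delta>: "\<delta> k \<le> \<tau> k / 16" "64 * (\<delta> k)\<^sup>2 \<le> s * \<epsilon> k"
      using elim k s by (simp_all add: field_simps)
    have "s * (L + \<epsilon> k) \<le> 1" "\<epsilon> k - \<epsilon> (Suc k) \<le> \<epsilon> k * \<delta> k" "\<tau> k \<le> 1 / 2" "k \<ge> 1"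
      "\<bar>\<tau> (Suc k) - \<tau> k\<bar> \<le> \<tau> k * \<delta> k"
      using elim k by auto
    note energy_recursion[OF s(1) this(1) k(5,6) this(2) \<delta> k(1) this(3) k(4) this(5) b\<beta> \<beta>0 \<beta>1
        K1 K2 K3 z0 y_step[OF this(4)] x_step[OF this(4)]]
    thus ?case using \<open>k \<ge> 1\<close> by (simp add: \<E>_def \<sigma>_def)
  qed
  thus ?thesis
  proof (rule damped_recursion_tendsto_0[rotated -1])
    show "0 \<le> \<E> k / \<epsilon> k" for k
      using energy_bounds(1)[OF \<epsilon>_pos s(1), of k] \<epsilon>_pos[of k]
      by (cases "k = 0") (simp_all add: \<E>_def)
    show "0 \<le> \<tau> k / 8" if "k \<ge> 1" for k using \<tau>_pos[OF that] by simp
    show "(\<lambda>k. \<tau> k / 8) \<longlonglongrightarrow> 0" using tendsto_divide[OF \<tau>_lim tendsto_const, of 8] by simp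
    show "\<not> summable (\<lambda>k. \<tau> k / 8)" using \<tau>_sum summable_divide_iff by simp
    have "\<sigma> \<longlonglongrightarrow> (32 * K\<^sup>2 / s * 0 + 8 * 0 + 128 / s * 0) * (norm z0)\<^sup>2"
      unfolding \<sigma>_def by (intro tendsto_intros \<tau>_\<epsilon> \<delta>_small)
    thus "\<sigma> \<longlonglongrightarrow> 0" by simp
  qed
qed

section \<open>Convergence and rates from the decay of the energy\<close>

lemma \<epsilon>_nonzero: "eventually (\<lambda>k. \<epsilon> k \<noteq> 0) sequentially"
  using eventually_ge_at_top[of "1::nat"] by eventually_elim (use \<epsilon>_pos in force)

lemma energy_smallo: "\<E> \<in> o(\<epsilon>)"
  by (rule smalloI_tendsto[OF relative_energy_tendsto_0 \<epsilon>_nonzero])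

lemma \<tau>_smallo: "\<tau> \<in> o(\<lambda>k. sqrt (\<epsilon> k))"
  by (rule smallo_sqrtI, rule smalloI_tendsto[OF \<tau>_\<epsilon> \<epsilon>_nonzero])

lemma \<epsilon>_smallo: "\<epsilon> \<in> o(\<lambda>k. sqrt (\<epsilon> k))"
proof (rule smallo_sqrtI, rule smalloI_tendsto[OF _ \<epsilon>_nonzero])
  show "(\<lambda>k. (\<epsilon> k)\<^sup>2 / \<epsilon> k) \<longlonglongrightarrow> 0"
    using \<epsilon>_lim by (simp add: power2_eq_square)
qed

lemma iterates_minus_centers: "(\<lambda>k. x k - center (\<epsilon> k)) \<longlonglongrightarrow> 0"
proof (rule Lim_null_comparison)
  show "(\<lambda>k. sqrt (2 * (\<E> k / \<epsilon> k))) \<longlonglongrightarrow> 0"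
    using tendsto_real_sqrt[OF tendsto_mult[OF tendsto_const[of 2] relative_energy_tendsto_0]] by simp
  show "eventually (\<lambda>k. norm (x k - center (\<epsilon> k)) \<le> sqrt (2 * (\<E> k / \<epsilon> k))) sequentially"
    using eventually_ge_at_top[of "1::nat"]
  proof eventually_elim
    case (elim k)
    have "(norm (x k - center (\<epsilon> k)))\<^sup>2 \<le> 2 * (\<E> k / \<epsilon> k)"
      using energy_bounds(3)[OF \<epsilon>_pos[OF elim] s(1), of "x k" "\<tau> k" "x (k - 1)"] elim by (simp add: \<E>_def)
    thus ?case by (rule real_le_rsqrt)
  qed
qed

lemma iterates_converge:
  obtains xs where "x \<longlonglongrightarrow> xs" "g xs = 0"
    "\<And>z. g z = 0 \<Longrightarrow> norm z \<le> norm xs \<Longrightarrow> z = xs" "\<And>z. g z = 0 \<Longrightarrow> norm xs \<le> norm z"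
proof -
  \<comment> \<open>The shift by one supplies positivity at every index, which
    \<open>\<epsilon>\<close> itself has only from 1 on.\<close>
  obtain xs where xs: "(\<lambda>k. center (\<epsilon> (Suc k))) \<longlonglongrightarrow> xs" "g xs = 0"
    "\<And>z. g z = 0 \<Longrightarrow> norm z \<le> norm xs \<Longrightarrow> z = xs" "\<And>z. g z = 0 \<Longrightarrow> norm xs \<le> norm z"
    using centers_converge[of "\<lambda>k. \<epsilon> (Suc k)", OF _ _ LIMSEQ_Suc[OF \<epsilon>_lim] z0] \<epsilon>_pos \<epsilon>_decr
    by (metis le_add1 plus_1_eq_Suc)
  have "x \<longlonglongrightarrow> xs"
    using tendsto_add[OF iterates_minus_centers LIMSEQ_imp_Suc[OF xs(1)]] by simp
  thus thesis using that xs by blast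
qed

text \<open>The kinetic vector \<open>u k\<close> equals \<open>1 - \<tau> k\<close> times the
  velocity plus \<open>\<tau> k\<close> times the distance vector from the center. The former is
  controlled by the energy, the latter is bounded, and \<open>\<tau>\<close> is itself
  \<open>o(sqrt \<epsilon>)\<close>.\<close>

lemma velocity_smallo: "(\<lambda>k. norm (x k - x (k - 1))) \<in> o(\<lambda>k. sqrt (\<epsilon> k))"
proof -
  define u where "u k = x k - x (k - 1) + \<tau> k *\<^sub>R (x (k - 1) - center (\<epsilon> k))" for k
  have "(\<lambda>k. (norm (u k))\<^sup>2) \<in> O(\<E>)"
  proof (rule bigoI)
    show "eventually (\<lambda>k. norm ((norm (u k))\<^sup>2) \<le> 2 * s * norm (\<E> k)) sequentially"
      using eventually_ge_at_top[of "1::nat"]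
    proof eventually_elim
      case (elim k)
      have "(norm (u k))\<^sup>2 \<le> 2 * s * \<E> k"
        using energy_bounds(4)[OF \<epsilon>_pos[OF elim] s(1), of "x k" "x (k - 1)" "\<tau> k"] elim by (simp add: \<E>_def u_def)
      also have "\<dots> \<le> 2 * s * norm (\<E> k)" using s by (intro mult_left_mono) auto
      finally show ?case by simp
    qed
  qed
  hence "(\<lambda>k. norm (u k)) \<in> o(\<lambda>k. sqrt (\<epsilon> k))"
    by (intro smallo_sqrtI) (rule landau_o.big_small_trans[OF _ energy_smallo])
  hence "(\<lambda>k. norm (u k) + \<tau> k) \<in> o(\<lambda>k. sqrt (\<epsilon> k))" by (rule sum_in_smallo[OF _ \<tau>_smallo])
  moreover have "(\<lambda>k. norm (x k - x (k - 1))) \<in> O(\<lambda>k. norm (u k) + \<tau> k)"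
  proof (rule bigoI)
    have ev: "eventually (\<lambda>k. norm (x k - center (\<epsilon> k)) < 1) sequentially"
      using tendsto_norm_zero[OF iterates_minus_centers] by (rule order_tendstoD) simp
    show "eventually (\<lambda>k. norm (norm (x k - x (k - 1))) \<le> 2 * norm (norm (u k) + \<tau> k)) sequentially"
      using eventually_ge_at_top[of "1::nat"] ev order_tendstoD(2)[OF \<tau>_lim, of "1/2", simplified]
    proof eventually_elim
      case (elim k)
      define d r where "d = x k - x (k - 1)" and "r = x k - center (\<epsilon> k)"
      have \<tau>: "0 < \<tau> k" "\<tau> k < 1 / 2" using \<tau>_pos elim by auto
      have "(1 - \<tau> k) *\<^sub>R d = u k - \<tau> k *\<^sub>R r" by (simp add: u_def d_def r_def algebra_simps)
      hence "(1 - \<tau> k) * norm d \<le> norm (u k) + \<tau> k * norm r"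
        using norm_triangle_ineq4[of "u k" "\<tau> k *\<^sub>R r"] norm_scaleR[of "1 - \<tau> k" d] \<tau> by simp
      also have "\<dots> \<le> norm (u k) + \<tau> k * 1"
        using elim \<tau> by (intro add_mono mult_left_mono) (auto simp: r_def)
      finally have "(1 - \<tau> k) * norm d \<le> norm (u k) + \<tau> k" by simp
      moreover have "1 / 2 * norm d \<le> (1 - \<tau> k) * norm d" using \<tau> by (intro mult_right_mono) auto
      ultimately show ?case using \<tau> by (simp add: d_def)
    qed
  qed
  ultimately show ?thesis by (rule landau_o.big_small_trans[rotated])
qed

lemma extrapolation_smallo: "(\<lambda>k. norm (y k - x k)) \<in> o(\<lambda>k. sqrt (\<epsilon> k))"
proof -
  obtain xs where "x \<longlonglongrightarrow> xs" by (rule iterates_converge)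
  hence "Bseq x" by (intro convergent_imp_Bseq) (auto simp: convergent_def)
  then obtain X where X: "0 < X" "\<And>k. norm (x k) \<le> X" by (auto simp: Bseq_def)
  obtain Kc where Kc: "0 < Kc" "eventually (\<lambda>k. norm (c k) \<le> Kc * norm ((\<tau> k)\<^sup>2)) sequentially"
    using landau_o.bigE[OF c_bound] by blast
  have "(\<lambda>k. norm (x k - x (k - 1)) + \<tau> k) \<in> o(\<lambda>k. sqrt (\<epsilon> k))"
    by (rule sum_in_smallo[OF velocity_smallo \<tau>_smallo])
  moreover have "(\<lambda>k. norm (y k - x k)) \<in> O(\<lambda>k. norm (x k - x (k - 1)) + \<tau> k)"
  proof (rule bigoI)
    show "eventually (\<lambda>k. norm (norm (y k - x k)) \<le> (1 + Kc * X) * norm (norm (x k - x (k - 1)) + \<tau> k)) sequentially"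
      using eventually_ge_at_top[of "1::nat"] Kc(2)
        order_tendstoD(2)[OF \<tau>_lim, of "1/4", simplified]
        order_tendstoD(1)[OF b_lim, of 2, simplified] order_tendstoD(2)[OF b_lim, of 4, simplified]
    proof eventually_elim
      case (elim k)
      have \<tau>: "0 < \<tau> k" "\<tau> k < 1 / 4" using \<tau>_pos elim by auto
      have "\<bar>b k\<bar> \<le> 1" using elim \<tau> by (simp add: field_simps)
      hence "norm (b k *\<^sub>R (x k - x (k - 1))) \<le> 1 * norm (x k - x (k - 1))"
        unfolding norm_scaleR by (intro mult_right_mono) auto
      moreover have "norm (c k *\<^sub>R x k) \<le> (Kc * X) * \<tau> k"
      proof -
        have "norm (c k *\<^sub>R x k) \<le> (Kc * (\<tau> k)\<^sup>2) * X"
          unfolding norm_scaleR using elim X Kc by (intro mult_mono) auto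
        also have "\<dots> \<le> (Kc * \<tau> k) * X"
          using \<tau> X Kc by (intro mult_right_mono mult_left_mono) (auto simp: power2_eq_square)
        finally show ?thesis by (simp add: ac_simps)
      qed
      moreover have "norm (y k - x k) \<le> norm (b k *\<^sub>R (x k - x (k - 1))) + norm (c k *\<^sub>R x k)"
        using norm_triangle_ineq4[of "b k *\<^sub>R (x k - x (k - 1))" "c k *\<^sub>R x k"] y_step[OF elim(1)] by simp
      ultimately have "norm (y k - x k) \<le> norm (x k - x (k - 1)) + (Kc * X) * \<tau> k" by linarith
      also have "\<dots> \<le> (1 + Kc * X) * (norm (x k - x (k - 1)) + \<tau> k)"
        using Kc X \<tau> by (simp add: algebra_simps)
      finally show ?case using \<tau> by simp
    qed
  qed
  ultimately show ?thesis by (rule landau_o.big_small_trans[rotated])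
qed

lemma extrapolated_converge:
  assumes "x \<longlonglongrightarrow> xs"
  shows "y \<longlonglongrightarrow> xs"
proof -
  have "(\<lambda>k. norm (y k - x k)) \<in> o(\<lambda>k. 1)"
  proof (rule landau_o.small.trans[OF extrapolation_smallo])
    show "(\<lambda>k. sqrt (\<epsilon> k)) \<in> o(\<lambda>k. 1)"
      using tendsto_real_sqrt[OF \<epsilon>_lim] by (intro smalloI_tendsto) simp_all
  qed
  hence "(\<lambda>k. norm (y k - x k)) \<longlonglongrightarrow> 0" using smalloD_tendsto by fastforce
  hence "(\<lambda>k. y k - x k) \<longlonglongrightarrow> 0" by (rule tendsto_norm_zero_cancel)
  from tendsto_add[OF this assms] show ?thesis by simp
qed

text \<open>By \<open>reg_grad_bound\<close> the squared regularised gradient is of the order of the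
  energy; removing \<open>\<epsilon> k *\<^sub>R x k\<close> costs only
  \<open>O(\<epsilon>)\<close>, as the iterates are bounded.\<close>

lemma gradient_smallo: "(\<lambda>k. norm (g (x k))) \<in> o(\<lambda>k. sqrt (\<epsilon> k))"
proof -
  obtain xs where "x \<longlonglongrightarrow> xs" by (rule iterates_converge)
  hence "Bseq x" by (intro convergent_imp_Bseq) (auto simp: convergent_def)
  then obtain X where X: "0 < X" "\<And>k. norm (x k) \<le> X" by (auto simp: Bseq_def)
  have "(\<lambda>k. (norm (reg_grad (\<epsilon> k) (x k)))\<^sup>2) \<in> O(\<E>)"
  proof (rule bigoI)
    show "eventually (\<lambda>k. norm ((norm (reg_grad (\<epsilon> k) (x k)))\<^sup>2) \<le> 2 * (L + 1) * norm (\<E> k)) sequentially"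
      using eventually_ge_at_top[of "1::nat"] order_tendstoD(2)[OF \<epsilon>_lim zero_less_one]
    proof eventually_elim
      case (elim k)
      note \<epsilon> = \<epsilon>_pos[OF elim(1)]
      have E: "0 \<le> \<E> k" "reg (\<epsilon> k) (x k) - reg (\<epsilon> k) (center (\<epsilon> k)) \<le> \<E> k"
        using energy_bounds(1,2)[OF \<epsilon> s(1)] elim by (simp_all add: \<E>_def)
      have "(norm (reg_grad (\<epsilon> k) (x k)))\<^sup>2 \<le> 2 * (L + \<epsilon> k) * (reg (\<epsilon> k) (x k) - reg (\<epsilon> k) (center (\<epsilon> k)))"
        using reg_grad_bound[OF reg_grad_center[OF \<epsilon>]] \<epsilon> by simp
      also have "\<dots> \<le> 2 * (L + \<epsilon> k) * \<E> k" using E L_pos \<epsilon> by (intro mult_left_mono) auto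
      also have "\<dots> \<le> 2 * (L + 1) * \<E> k" using E elim by (intro mult_right_mono) auto
      finally show ?case using E by simp
    qed
  qed
  hence "(\<lambda>k. norm (reg_grad (\<epsilon> k) (x k))) \<in> o(\<lambda>k. sqrt (\<epsilon> k))"
    by (intro smallo_sqrtI) (rule landau_o.big_small_trans[OF _ energy_smallo])
  hence "(\<lambda>k. norm (reg_grad (\<epsilon> k) (x k)) + X * \<epsilon> k) \<in> o(\<lambda>k. sqrt (\<epsilon> k))"
    using X \<epsilon>_smallo by (intro sum_in_smallo) auto
  moreover have "(\<lambda>k. norm (g (x k))) \<in> O(\<lambda>k. norm (reg_grad (\<epsilon> k) (x k)) + X * \<epsilon> k)"
  proof (rule bigoI)
    show "eventually (\<lambda>k. norm (norm (g (x k))) \<le> 1 * norm (norm (reg_grad (\<epsilon> k) (x k)) + X * \<epsilon> k)) sequentially"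
      using eventually_ge_at_top[of "1::nat"]
    proof eventually_elim
      case (elim k)
      note \<epsilon> = \<epsilon>_pos[OF elim(1)]
      have "g (x k) = reg_grad (\<epsilon> k) (x k) - \<epsilon> k *\<^sub>R x k" by (simp add: reg_grad_def)
      hence "norm (g (x k)) \<le> norm (reg_grad (\<epsilon> k) (x k)) + norm (\<epsilon> k *\<^sub>R x k)"
        using norm_triangle_ineq4 by metis
      moreover have "norm (\<epsilon> k *\<^sub>R x k) \<le> X * \<epsilon> k"
        using X(2)[of k] \<epsilon> by (simp add: mult.commute)
      ultimately show ?case by simp
    qed
  qed
  ultimately show ?thesis by (rule landau_o.big_small_trans[rotated])
qed

lemma gradient_extrapolated_smallo: "(\<lambda>k. norm (g (y k))) \<in> o(\<lambda>k. sqrt (\<epsilon> k))"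
proof -
  have "(\<lambda>k. norm (g (x k)) + L * norm (y k - x k)) \<in> o(\<lambda>k. sqrt (\<epsilon> k))"
    using gradient_smallo extrapolation_smallo L_pos by (intro sum_in_smallo) auto
  moreover have "(\<lambda>k. norm (g (y k))) \<in> O(\<lambda>k. norm (g (x k)) + L * norm (y k - x k))"
  proof (rule bigoI, rule always_eventually, rule allI)
    fix k
    have "norm (g (y k) - g (x k)) \<le> L * norm (y k - x k)"
      using lipschitz_onD[OF lipschitz, of "y k" "x k"] by (simp add: dist_norm)
    thus "norm (norm (g (y k))) \<le> 1 * norm (norm (g (x k)) + L * norm (y k - x k))"
      using norm_triangle_sub[of "g (y k)" "g (x k)"] by simp
  qed
  ultimately show ?thesis by (rule landau_o.big_small_trans[rotated])
qed

lemma f_above_z0: "f z0 \<le> f w"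
  using above_tangent[of z0 w] z0 by simp

text \<open>The energy is \<open>o(\<epsilon>)\<close>; the order \<open>\<epsilon>\<close> comes
  from the regularisation at \<open>z0\<close>, which bounds the minimum of
  \<open>reg (\<epsilon> k)\<close> from above.\<close>

lemma value_bigo: "(\<lambda>k. f (x k) - f z0) \<in> O(\<epsilon>)"
proof -
  have "(\<lambda>k. \<E> k + (norm z0)\<^sup>2 / 2 * \<epsilon> k) \<in> O(\<epsilon>)"
    using landau_o.small_imp_big[OF energy_smallo] by (intro sum_in_bigo) auto
  moreover have "(\<lambda>k. f (x k) - f z0) \<in> O(\<lambda>k. \<E> k + (norm z0)\<^sup>2 / 2 * \<epsilon> k)"
  proof (rule bigoI)
    show "eventually (\<lambda>k. norm (f (x k) - f z0) \<le> 1 * norm (\<E> k + (norm z0)\<^sup>2 / 2 * \<epsilon> k)) sequentially"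
      using eventually_ge_at_top[of "1::nat"]
    proof eventually_elim
      case (elim k)
      note \<epsilon> = \<epsilon>_pos[OF elim(1)]
      have "reg (\<epsilon> k) (x k) - reg (\<epsilon> k) (center (\<epsilon> k)) \<le> \<E> k"
        using energy_bounds(2)[OF \<epsilon> s(1)] elim by (simp add: \<E>_def)
      moreover have "reg (\<epsilon> k) (center (\<epsilon> k)) \<le> reg (\<epsilon> k) z0"
        using reg_above_center[OF reg_grad_center[OF \<epsilon>], of z0] \<epsilon>
        by (smt (verit) half_gt_zero mult_nonneg_nonneg zero_le_power2)
      moreover have "f (x k) \<le> reg (\<epsilon> k) (x k)" using \<epsilon> by (simp add: reg_def)
      ultimately have "f (x k) - f z0 \<le> \<E> k + (norm z0)\<^sup>2 / 2 * \<epsilon> k"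
        by (simp add: reg_def ac_simps)
      thus ?case using f_above_z0[of "x k"] by simp
    qed
  qed
  ultimately show ?thesis by (rule landau_o.big.trans[rotated])
qed

text \<open>The descent lemma from \<open>x k\<close> to \<open>y k\<close> adds only products of
  two quantities that are \<open>o(sqrt \<epsilon>)\<close>.\<close>

lemma value_extrapolated_bigo: "(\<lambda>k. f (y k) - f z0) \<in> O(\<epsilon>)"
proof -
  have sq: "(\<lambda>k. sqrt (\<epsilon> k) * sqrt (\<epsilon> k)) \<in> O(\<epsilon>)"
    by (intro bigoI[of _ 1] always_eventually) (simp flip: abs_mult)
  have "(\<lambda>k. norm (g (x k)) * norm (y k - x k)) \<in> O(\<epsilon>)"
    by (rule landau_o.big.trans[OF landau_o.big.mult sq])
       (intro landau_o.small_imp_big gradient_smallo extrapolation_smallo)+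
  moreover have "(\<lambda>k. norm (y k - x k) * norm (y k - x k)) \<in> O(\<epsilon>)"
    by (rule landau_o.big.trans[OF landau_o.big.mult sq])
       (intro landau_o.small_imp_big extrapolation_smallo)+
  ultimately have "(\<lambda>k. (f (x k) - f z0) + norm (g (x k)) * norm (y k - x k)
      + L / 2 * (norm (y k - x k) * norm (y k - x k))) \<in> O(\<epsilon>)"
    using L_pos by (intro sum_in_bigo(1) value_bigo) auto
  moreover have "(\<lambda>k. f (y k) - f z0) \<in> O(\<lambda>k. (f (x k) - f z0) + norm (g (x k)) * norm (y k - x k)
      + L / 2 * (norm (y k - x k) * norm (y k - x k)))"
  proof (rule bigoI, rule always_eventually, rule allI)
    fix k
    have "f (y k) \<le> f (x k) + g (x k) \<bullet> (y k - x k) + L / 2 * (norm (y k - x k) * norm (y k - x k))"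
      using below_parabola[of "x k" "y k - x k"] by (simp add: power2_eq_square)
    thus "norm (f (y k) - f z0) \<le> 1 * norm ((f (x k) - f z0) + norm (g (x k)) * norm (y k - x k)
      + L / 2 * (norm (y k - x k) * norm (y k - x k)))"
      using norm_cauchy_schwarz[of "g (x k)" "y k - x k"] f_above_z0[of "y k"] by simp
  qed
  ultimately show ?thesis by (rule landau_o.big.trans[rotated])
qed

end

subsection \<open>Asymptotics of the coefficients\<close>

text \<open>Lets the limits below use the closed formulas. \<open>Suc (k - 1) = k\<close> is
  included because \<open>b_coeff\<close> at \<open>k - 1\<close> tests degeneracy at
  \<open>Suc (k - 1)\<close>.\<close>

lemma eventually_nondegenerate:
  assumes "0 < s" "0 < a" "0 < c" "0 < p" "0 < q"
  shows "eventually (\<lambda>k. k \<ge> 2 \<and> s * eps_seq c p (k - 1) < 1 \<and> s * eps_seq c p k < 1 \<and>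
    0 < q_seq a q (k - 1) \<and> 0 < q_seq a q k \<and> Suc (k - 1) = k \<and>
    \<not> degenerate_step s (eps_seq c p) (q_seq a q) k) sequentially"
proof -
  have "(\<lambda>k. s * (c / real (k - 1) powr p)) \<longlonglongrightarrow> 0" "(\<lambda>k. s * (c / real k powr p)) \<longlonglongrightarrow> 0"
    using assms by real_asymp+
  hence "eventually (\<lambda>k. s * (c / real (k - 1) powr p) < 1) sequentially"
    "eventually (\<lambda>k. s * (c / real k powr p) < 1) sequentially"
    by (auto intro: order_tendstoD(2))
  thus ?thesis using eventually_ge_at_top[of "2::nat"]
  proof eventually_elim
    case (elim k)
    have "0 < q_seq a q (k - 1)" "0 < q_seq a q k" using elim assms by (auto simp: q_seq_def)
    thus ?case using elim by (auto simp: degenerate_step_def eps_seq_def)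
  qed
qed

text \<open>The relative increment of \<open>\<epsilon>\<close> is about \<open>p / k\<close>, and
  \<open>1 / k\<close> is small against \<open>\<tau>\<close> because \<open>q < 1\<close>; the
  explicit factor \<open>\<epsilon>\<close> tends to 0 as well.\<close>

lemma eps_increment_limit:
  fixes s a c p q :: real
  assumes "0 < s" "0 < a" "0 < c" "0 < p" "0 < q" "q < 1"
  shows "(\<lambda>k. (s * (c / real (k - 1) powr p) - s * (c / real k powr p)) / (s / (a * real (k - 1) powr q)))
    \<longlonglongrightarrow> 0"
proof -
  have "(\<lambda>k. (1 - (real (k - 1) / real k) powr p) * real k) \<longlonglongrightarrow> p"
    "(\<lambda>k. s * (c / real (k - 1) powr p)) \<longlonglongrightarrow> 0"
    "(\<lambda>k. (1 / real k) / (s / (a * real (k - 1) powr q))) \<longlonglongrightarrow> 0"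
    using assms by real_asymp+
  from tendsto_mult[OF this(1) tendsto_mult[OF this(2,3)]]
  have "(\<lambda>k. (1 - (real (k - 1) / real k) powr p) * real k * (s * (c / real (k - 1) powr p)
      * ((1 / real k) / (s / (a * real (k - 1) powr q))))) \<longlonglongrightarrow> 0" by simp
  thus ?thesis
  proof (rule Lim_transform_eventually)
    show "eventually (\<lambda>k. (1 - (real (k - 1) / real k) powr p) * real k * (s * (c / real (k - 1) powr p)
        * ((1 / real k) / (s / (a * real (k - 1) powr q))))
      = (s * (c / real (k - 1) powr p) - s * (c / real k powr p)) / (s / (a * real (k - 1) powr q))) sequentially"
      using eventually_ge_at_top[of "2::nat"]
    proof eventually_elim
      case (elim k)
      define u v w where "u = real (k - 1) powr p" and "v = real k powr p" and "w = real (k - 1) powr q"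
      have pos: "0 < u" "0 < v" "0 < w" "0 < real k" using elim by (auto simp: u_def v_def w_def)
      have ratio: "(real (k - 1) / real k) powr p = u / v" by (simp add: u_def v_def powr_divide)
      show ?case unfolding ratio u_def[symmetric] v_def[symmetric] w_def[symmetric]
        using pos assms(1,2) by (simp add: field_simps)
    qed
  qed
qed

text \<open>With \<open>t k = s / Q\<close>, \<open>u = 1 - e (k - 1)\<close> and
  \<open>v = 1 - e k\<close>, the coefficient is
  \<open>(Q / Q') * (1 - t k) * (u\<^sup>2 - 2 * t k) / (u * v)\<close>. The factor
  \<open>1 - t k\<close> contributes 1 to the limit and \<open>u\<^sup>2 - 2 * t k\<close>
  contributes 2; the variations of \<open>Q\<close> and \<open>e\<close> contribute 0.\<close>

lemma b_coeff_limit: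
  assumes "0 < s" "0 < a" "0 < c" "0 < p" "0 < q" "q < 1"
  shows "(\<lambda>k. (1 - b_coeff s (eps_seq c p) (q_seq a q) (k - 1)) / (s / q_seq a q k)) \<longlonglongrightarrow> 3"
proof -
  define t where "t k = s / (a * real (k - 1) powr q)" for k :: nat
  define e where "e k = s * (c / real k powr p)" for k :: nat
  have lims: "(\<lambda>k. (1 - (real (k - 1) / real k) powr q) / (s / (a * real k powr q))) \<longlonglongrightarrow> 0"
    "(\<lambda>k. (e (k - 1) - e k) / t k) \<longlonglongrightarrow> 0" "t \<longlonglongrightarrow> 0" "(\<lambda>k. e (k - 1)) \<longlonglongrightarrow> 0" "e \<longlonglongrightarrow> 0"
    unfolding t_def e_def using assms
    by (real_asymp, intro eps_increment_limit, simp_all, real_asymp+)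
  have "(\<lambda>k. (1 - (real (k - 1) / real k) powr q) / (s / (a * real k powr q)) + 1
      + (1 - t k) * (((e (k - 1) - e k) / t k + 2 / (1 - e (k - 1))) / (1 - e k)))
    \<longlonglongrightarrow> 0 + 1 + (1 - 0) * ((0 + 2 / (1 - 0)) / (1 - 0))"
    by (intro tendsto_intros lims) auto
  hence "(\<lambda>k. (1 - (real (k - 1) / real k) powr q) / (s / (a * real k powr q)) + 1
      + (1 - t k) * (((e (k - 1) - e k) / t k + 2 / (1 - e (k - 1))) / (1 - e k))) \<longlonglongrightarrow> 3"
    by simp
  thus ?thesis
  proof (rule Lim_transform_eventually)
    show "eventually (\<lambda>k. (1 - (real (k - 1) / real k) powr q) / (s / (a * real k powr q)) + 1
      + (1 - t k) * (((e (k - 1) - e k) / t k + 2 / (1 - e (k - 1))) / (1 - e k))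
      = (1 - b_coeff s (eps_seq c p) (q_seq a q) (k - 1)) / (s / q_seq a q k)) sequentially"
      using eventually_nondegenerate[OF assms(1-5)]
    proof eventually_elim
      case (elim k)
      define Q Q' u v where "Q = q_seq a q (k - 1)" and "Q' = q_seq a q k"
        and "u = 1 - e (k - 1)" and "v = 1 - e k"
      have pos: "0 < Q" "0 < Q'" "0 < u" "0 < v"
        using elim by (auto simp: Q_def Q'_def u_def v_def e_def eps_seq_def)
      have \<rho>: "(real (k - 1) / real k) powr q = Q / Q'"
        using assms(2) by (simp add: Q_def Q'_def q_seq_def powr_divide)
      have b: "b_coeff s (eps_seq c p) (q_seq a q) (k - 1) = (Q - s) * (u\<^sup>2 * Q - 2 * s) / (u * v * Q * Q')"
        using elim by (simp add: b_coeff_def Q_def Q'_def u_def v_def e_def eps_seq_def)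
      have t: "t k = s / Q" "s / (a * real k powr q) = s / Q'" by (simp_all add: t_def Q_def Q'_def q_seq_def)
      have e: "e (k - 1) - e k = v - u" by (simp add: u_def v_def)
      show ?case unfolding b \<rho> t e u_def[symmetric] v_def[symmetric] Q'_def[symmetric]
        using pos assms(1) by (simp add: field_simps power2_eq_square)
    qed
  qed
qed

text \<open>Taking \<open>s / Q\<close> out of the bracket exhibits \<open>c_coeff\<close> as
  \<open>2 * (s / Q')\<^sup>2\<close> times factors that tend to 1.\<close>

lemma c_coeff_limit:
  assumes "0 < s" "0 < a" "0 < c" "0 < p" "0 < q" "q < 1"
  shows "(\<lambda>k. c_coeff s (eps_seq c p) (q_seq a q) k / (s / q_seq a q k)\<^sup>2) \<longlonglongrightarrow> 2"
proof -
  define t where "t k = s / (a * real (k - 1) powr q)" for k :: nat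
  define e where "e k = s * (c / real k powr p)" for k :: nat
  have lims: "(\<lambda>k. (real k / real (k - 1)) powr q) \<longlonglongrightarrow> 1"
    "(\<lambda>k. (e (k - 1) - e k) / t k) \<longlonglongrightarrow> 0" "(\<lambda>k. e (k - 1)) \<longlonglongrightarrow> 0" "e \<longlonglongrightarrow> 0"
    unfolding t_def e_def using assms
    by (real_asymp, intro eps_increment_limit, simp_all, real_asymp+)
  have "(\<lambda>k. 2 / ((1 - e (k - 1)) * (1 - e k)\<^sup>2) * ((1 - e k - (e (k - 1) - e k) / t k)
      * (real k / real (k - 1)) powr q)) \<longlonglongrightarrow> 2 / ((1 - 0) * (1 - 0)\<^sup>2) * ((1 - 0 - 0) * 1)"
    by (intro tendsto_intros lims) auto
  hence "(\<lambda>k. 2 / ((1 - e (k - 1)) * (1 - e k)\<^sup>2) * ((1 - e k - (e (k - 1) - e k) / t k)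
      * (real k / real (k - 1)) powr q)) \<longlonglongrightarrow> 2"
    by simp
  thus ?thesis
  proof (rule Lim_transform_eventually)
    show "eventually (\<lambda>k. 2 / ((1 - e (k - 1)) * (1 - e k)\<^sup>2) * ((1 - e k - (e (k - 1) - e k) / t k)
      * (real k / real (k - 1)) powr q) = c_coeff s (eps_seq c p) (q_seq a q) k / (s / q_seq a q k)\<^sup>2) sequentially"
      using eventually_nondegenerate[OF assms(1-5)]
    proof eventually_elim
      case (elim k)
      define Q Q' E E' u v where "Q = q_seq a q (k - 1)" and "Q' = q_seq a q k"
        and "E = eps_seq c p (k - 1)" and "E' = eps_seq c p k"
        and "u = 1 - s * E" and "v = 1 - s * E'"
      have pos: "0 < Q" "0 < Q'" "0 < u" "0 < v"
        using elim by (auto simp: Q_def Q'_def u_def v_def E_def E'_def)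
      have \<rho>: "(real k / real (k - 1)) powr q = Q' / Q"
        using assms(2) by (simp add: Q_def Q'_def q_seq_def powr_divide)
      have c: "c_coeff s (eps_seq c p) (q_seq a q) k
          = 2 * s / (u * v\<^sup>2 * Q') * (s / Q - s\<^sup>2 * E' / Q - s * (E - E'))"
        using elim by (simp add: c_coeff_def Q_def Q'_def u_def v_def E_def E'_def)
      have e: "1 - e (k - 1) = u" "1 - e k = v" "e (k - 1) - e k = s * (E - E')" "t k = s / Q"
        by (simp_all add: t_def Q_def q_seq_def u_def v_def e_def E_def E'_def eps_seq_def right_diff_distrib)
      have "v - s * (E - E') / (s / Q) = (s / Q - s\<^sup>2 * E' / Q - s * (E - E')) * (Q / s)"
        unfolding v_def using pos assms(1) by (simp add: field_simps power2_eq_square)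
      thus ?case unfolding c \<rho> e Q'_def[symmetric]
        using pos assms(1) by (simp add: power2_eq_square)
    qed
  qed
qed

section \<open>Power-law parameters and conclusion\<close>

lemma eps_seq_eq: "eps_seq c p = (\<lambda>k. c * real k powr (- p))"
  by (simp add: fun_eq_iff eps_seq_def powr_minus_divide)

lemma sqrt_eps_seq_eq: "sqrt (eps_seq c p k) = sqrt c * real k powr (- (p / 2))"
  by (simp add: eps_seq_eq real_sqrt_mult powr_half_sqrt[symmetric] powr_powr)

theorem theorem1:
  fixes f :: "'a :: {real_inner, complete_space} \<Rightarrow> real"
    and g :: "'a \<Rightarrow> 'a"
    and L s a c p q :: real
    and x y :: "nat \<Rightarrow> 'a"
  assumes "convex_on UNIV f"
    and gradient: "\<And>z. GDERIV f z :> g z"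
    and "continuous_on UNIV g"
    and "L > 0"
    and "lipschitz_on L UNIV g"
    and "minimizers f \<noteq> {}"
    and "0 < s" and "s < 1 / L"
    and "a > 0" and "c > 0" and "p > 0" and "0 < q" and "q < 1"
    and "p < 2 * q"
    and y_step: "\<And>k. k \<ge> 1 \<Longrightarrow>
      y k = x k + b_coeff s (eps_seq c p) (q_seq a q) (k - 1) *\<^sub>R (x k - x (k - 1))
                - c_coeff s (eps_seq c p) (q_seq a q) k *\<^sub>R x k"
    and x_step: "\<And>k. k \<ge> 1 \<Longrightarrow>
      x (k + 1) = y k - s *\<^sub>R g (y k) - (s * eps_seq c p k) *\<^sub>R y k"
  shows "(\<exists>xs. (\<forall>z. is_arg_min norm (\<lambda>w. w \<in> minimizers f) z \<longleftrightarrow> z = xs)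
              \<and> x \<longlonglongrightarrow> xs \<and> y \<longlonglongrightarrow> xs)
    \<and> (\<lambda>k. f (x k) - (INF z. f z)) \<in> O(\<lambda>k. real k powr (- p))
    \<and> (\<lambda>k. f (y k) - (INF z. f z)) \<in> O(\<lambda>k. real k powr (- p))
    \<and> (\<lambda>k. norm (g (x k))) \<in> o(\<lambda>k. real k powr (- (p / 2)))
    \<and> (\<lambda>k. norm (g (y k))) \<in> o(\<lambda>k. real k powr (- (p / 2)))
    \<and> (\<lambda>k. norm (x k - x (k - 1))) \<in> o(\<lambda>k. real k powr (- (p / 2)))"
proof -
  define \<epsilon> where "\<epsilon> = eps_seq c p"
  define \<tau> where "\<tau> k = s / q_seq a q k" for k
  \<comment> \<open>The relative variations of \<open>\<epsilon>\<close> and \<open>\<tau>\<close>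
    are asymptotic to \<open>p / k\<close> and \<open>q / k\<close>; the constant exceeds both
    \<open>p\<close> and \<open>q\<close> strictly.\<close>
  define \<delta> where "\<delta> k = (p + q + 1) / real k" for k :: nat
  define b where "b k = b_coeff s (eps_seq c p) (q_seq a q) (k - 1)" for k
  define c' where "c' = c_coeff s (eps_seq c p) (q_seq a q)"
  interpret smooth_convex f g L
    using assms by unfold_locales auto
  obtain z0 where z0: "z0 \<in> minimizers f" using assms(6) by blast
  have pos: "0 < s" "0 < a" "0 < c" "0 < p" "0 < q" "q < 1" "p < 2 * q" using assms by auto
  have ratio: "(\<lambda>k. (1 - (real k / real (Suc k)) powr r) * real k) \<longlonglongrightarrow> r" if "0 < r" for r :: real
    using that by real_asymp
  have ratio_le: "eventually (\<lambda>k. 1 - (real k / real (Suc k)) powr r \<le> \<delta> k) sequentially"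
    if "0 < r" "r < p + q + 1" for r
    using order_tendstoD(2)[OF ratio[OF that(1)] that(2)] eventually_gt_at_top[of "0::nat"]
    by eventually_elim (simp add: \<delta>_def pos_le_divide_eq)
  have p_ratio: "eventually (\<lambda>k. 1 - (real k / real (Suc k)) powr p \<le> \<delta> k) sequentially"
    and q_ratio: "eventually (\<lambda>k. 1 - (real k / real (Suc k)) powr q \<le> \<delta> k) sequentially"
    using pos by (auto intro!: ratio_le simp del: of_nat_Suc)
  interpret tikhonov_inertial f g L s \<epsilon> \<tau> \<delta> b c' x y z0
  proof
    show "0 < s" "s * L < 1" using assms by (auto simp: pos_less_divide_eq)
    show "g z0 = 0" using z0 minimizers_iff by simp
    show "0 < \<epsilon> k" "0 < \<tau> k" if "k \<ge> 1" for k
      using that pos by (auto simp: \<epsilon>_def eps_seq_def \<tau>_def q_seq_def)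
    show "\<epsilon> (Suc k) \<le> \<epsilon> k" if "k \<ge> 1" for k
      unfolding \<epsilon>_def eps_seq_def using that pos by (intro divide_left_mono powr_mono2) auto
    show "\<epsilon> \<longlonglongrightarrow> 0" unfolding \<epsilon>_def eps_seq_def using pos by real_asymp
    show "\<tau> \<longlonglongrightarrow> 0" unfolding \<tau>_def q_seq_def using pos by real_asymp
    \<comment> \<open>A constant times \<open>k powr (p - 2 * q)\<close>: the hypothesis
      \<open>p < 2 * q\<close> enters here.\<close>
    show "(\<lambda>k. (\<tau> k)\<^sup>2 / \<epsilon> k) \<longlonglongrightarrow> 0"
      unfolding \<tau>_def q_seq_def \<epsilon>_def eps_seq_def using pos by real_asymp
    show "(\<lambda>k. \<delta> k / \<tau> k) \<longlonglongrightarrow> 0"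
      unfolding \<tau>_def q_seq_def \<delta>_def using pos by real_asymp
    \<comment> \<open>Of order \<open>k powr (p - 2)\<close>, where
      \<open>p < 2 * q < 2\<close>.\<close>
    show "(\<lambda>k. (\<delta> k)\<^sup>2 / \<epsilon> k) \<longlonglongrightarrow> 0"
      unfolding \<epsilon>_def eps_seq_def \<delta>_def using pos by real_asymp
    show "\<not> summable \<tau>"
    proof
      assume "summable \<tau>"
      moreover have "\<tau> = (\<lambda>k. s / a * real k powr (- q))"
        by (simp add: fun_eq_iff \<tau>_def q_seq_def powr_minus_divide)
      ultimately have "summable (\<lambda>k. real k powr (- q))" using pos summable_cmult_iff[of "s / a"] by simp
      thus False using pos by (simp add: summable_real_powr_iff)
    qed
    show "(\<lambda>k. (1 - b k) / \<tau> k) \<longlonglongrightarrow> 3"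
      unfolding b_def \<tau>_def by (rule b_coeff_limit[OF pos(1-6)])
    show "c' \<in> O(\<lambda>k. (\<tau> k)\<^sup>2)"
    proof (rule bigoI_tendsto)
      show "(\<lambda>k. c' k / (\<tau> k)\<^sup>2) \<longlonglongrightarrow> 2"
        unfolding c'_def \<tau>_def by (rule c_coeff_limit[OF pos(1-6)])
      show "eventually (\<lambda>k. (\<tau> k)\<^sup>2 \<noteq> 0) sequentially"
        using eventually_gt_at_top[of "0::nat"] by eventually_elim (use pos in \<open>simp add: \<tau>_def q_seq_def\<close>)
    qed
    show "eventually (\<lambda>k. \<epsilon> k - \<epsilon> (Suc k) \<le> \<epsilon> k * \<delta> k) sequentially"
      using p_ratio eventually_gt_at_top[of "0::nat"]
    proof eventually_elim
      case (elim k)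
      have "\<epsilon> k - \<epsilon> (Suc k) = \<epsilon> k * (1 - (real k / real (Suc k)) powr p)"
        using elim by (simp add: \<epsilon>_def eps_seq_def powr_divide field_simps)
      also have "\<dots> \<le> \<epsilon> k * \<delta> k"
        using elim pos by (intro mult_left_mono) (auto simp: \<epsilon>_def eps_seq_def)
      finally show ?case .
    qed
    show "eventually (\<lambda>k. \<bar>\<tau> (Suc k) - \<tau> k\<bar> \<le> \<tau> k * \<delta> k) sequentially"
      using q_ratio eventually_gt_at_top[of "0::nat"]
    proof eventually_elim
      case (elim k)
      have "\<tau> (Suc k) \<le> \<tau> k" unfolding \<tau>_def q_seq_def
        using elim pos by (intro divide_left_mono mult_left_mono powr_mono2) auto
      hence "\<bar>\<tau> (Suc k) - \<tau> k\<bar> = \<tau> k * (1 - (real k / real (Suc k)) powr q)"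
        using elim pos by (simp add: \<tau>_def q_seq_def powr_divide field_simps)
      also have "\<dots> \<le> \<tau> k * \<delta> k"
        using elim pos by (intro mult_left_mono) (auto simp: \<tau>_def q_seq_def)
      finally show ?case .
    qed
    show "y k = x k + b k *\<^sub>R (x k - x (k - 1)) - c' k *\<^sub>R x k" if "k \<ge> 1" for k
      using y_step[OF that] by (simp add: b_def c'_def)
    show "x (Suc k) = y k - s *\<^sub>R reg_grad (\<epsilon> k) (y k)" if "k \<ge> 1" for k
      using x_step[OF that] by (simp add: reg_grad_def \<epsilon>_def algebra_simps)
  qed
  obtain xs where xs: "x \<longlonglongrightarrow> xs" "g xs = 0"
    "\<And>z. g z = 0 \<Longrightarrow> norm z \<le> norm xs \<Longrightarrow> z = xs" "\<And>z. g z = 0 \<Longrightarrow> norm xs \<le> norm z"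
    by (rule iterates_converge) blast
  have "is_arg_min norm (\<lambda>w. w \<in> minimizers f) z \<longleftrightarrow> z = xs" for z
    unfolding is_arg_min_linorder minimizers_iff using xs(2-4) by blast
  moreover have "y \<longlonglongrightarrow> xs" by (rule extrapolated_converge[OF xs(1)])
  moreover have "(INF z. f z) = f z0"
    by (rule cInf_eq_minimum) (auto intro: f_above_z0)
  moreover have "O(\<epsilon>) = O(\<lambda>k. real k powr (- p))"
    unfolding \<epsilon>_def eps_seq_eq using pos by simp
  moreover have "o(\<lambda>k. sqrt (\<epsilon> k)) = o(\<lambda>k. real k powr (- (p / 2)))"
    unfolding \<epsilon>_def sqrt_eps_seq_eq using pos by simp
  ultimately show ?thesis
    using xs(1) value_bigo value_extrapolated_bigo gradient_smallo gradient_extrapolated_smallo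
      velocity_smallo by auto
qed

end
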